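(* Fix a constant $C_0>2$ and let $\Omega$ be the set of sufficiently large positive integers $M$ (i.e. $M\ge M_0$ for some fixed threshold $M_0$) such that: (i) $M$ is square-free; (ii) $0.9\log\log M<\omega(M)<1.1\log\log M$; (iii) $M$ can be written as $M=Am$ with $3\le A\le(\log M)^{0.1}$ and $P^-(m)>(\log M)^{C_0}$. Then $\Omega$ has asymptotic density $e^{-\gamma}\frac{3}{5\pi^2C_0}$, where $\gamma$ is the Euler constant; that is, $\#\{M\le X: M\in\Omega\}=\left(e^{-\gamma}\frac{3}{5\pi^2C_0}+o(1)\right)X$ as $X\to\infty$.
   Context: $\omega(n)$ denotes the number of distinct prime divisors of $n$, and $P^-(n)$ denotes the least prime divisor of $n$. *)

theory Defs
  imports "HOL-Analysis.Analysis" "HOL-Computational_Algebra.Squarefree"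
begin

definition omega :: "nat \<Rightarrow> nat" where
  "omega n = card {p. prime p \<and> p dvd n}"

(* Unspecified for n = 1.  In Omega_set this value is immaterial: m = 1 would force
   M = A \<le> (ln M) powr 0.1, which is impossible for A \<ge> 3. *)
definition least_prime_divisor :: "nat \<Rightarrow> nat" where
  "least_prime_divisor n = (LEAST p. prime p \<and> p dvd n)"

definition Omega_set :: "real \<Rightarrow> real \<Rightarrow> nat set" where
  "Omega_set C\<^sub>0 M\<^sub>0 = {M. M > 0 \<and> real M \<ge> M\<^sub>0 \<and>
     squarefree M \<and>
     0.9 * ln (ln (real M)) < real (omega M) \<and> real (omega M) < 1.1 * ln (ln (real M)) \<and>
     (\<exists>A m. M = A * m \<and> 3 \<le> A \<and> real A \<le> ln (real M) powr 0.1 \<and>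
            real (least_prime_divisor m) > ln (real M) powr C\<^sub>0)}"

definition has_asymptotic_density :: "nat set \<Rightarrow> real \<Rightarrow> bool" where
  "has_asymptotic_density S d \<longleftrightarrow>
     ((\<lambda>X::real. real (card {n \<in> S. real n \<le> X}) / X) \<longlongrightarrow> d) at_top"

end

theory Submission
  imports Defs "HOL-Number_Theory.Prime_Powers" "HOL-Real_Asymp.Real_Asymp"
begin

text \<open>
  Replacing \<open>ln M\<close> by \<open>ln X\<close> or \<open>ln X / 2\<close> (all but \<open>sqrt X\<close> of the integers up to \<open>X\<close> have their
  logarithm in between) turns condition (iii) into: \<open>M = A * m\<close> with \<open>A \<le> z\<close> and \<open>m\<close> free of primes up
  to \<open>y\<close>, where \<open>z\<close> and \<open>y\<close> are powers of \<open>ln X\<close>. The factorization is unique because \<open>z \<le> y\<close>.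
  As \<open>y\<close> is only a power of \<open>ln X\<close>, Legendre's sieve with Rankin's trick shows that the number of
  such \<open>m \<le> X / A\<close> is asymptotically \<open>X / A\<close> times the product of \<open>1 - 1/p\<close> over \<open>p \<le> y\<close>.
  Mertens' third theorem evaluates this product as \<open>exp (-\<gamma>) / ln y\<close>, and the sum of \<open>1/A\<close> over
  squarefree \<open>A \<le> z\<close> is asymptotically \<open>(6 / pi\<^sup>2) * ln z\<close>; since \<open>ln z / ln y\<close> tends to \<open>0.1 / C\<^sub>0\<close>,
  the density follows. Condition (ii) costs nothing by the Hardy--Ramanujan theorem, and neither does
  squarefreeness of \<open>m\<close>, as \<open>X / p\<^sup>2\<close> summed over \<open>p > y\<close> is \<open>o(X)\<close>.
\<close>

subsection \<open>Chebyshev's bound and Mertens' first theorem\<close>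

text \<open>For the sums over primes no rate of convergence is needed: they enter only through
  limits, so the constants in Chebyshev's bound and in Mertens' first theorem may be crude. What has
  to be exact is the factor \<open>exp (-\<gamma>)\<close>. The elementary route yields only some
  constant \<open>B\<close> in Mertens' second theorem, and identifying it is the sole purpose of
  the zeta function and of the Abelian theorem. The two values \<open>ln X\<close> and
  \<open>ln X / 2\<close> are played against each other: the largest \<open>z\<close> with the
  smallest \<open>y\<close> gives an upper bound for the count, the smallest \<open>z\<close> with
  the largest \<open>y\<close> a lower bound. Both have the same limit, because only
  \<open>ln z / ln y\<close> matters and a constant factor changes each logarithm by a bounded
  amount. The sieve error is \<open>X powr (-\<epsilon>)\<close> times roughly
  \<open>exp (y powr \<epsilon> * ln y)\<close>. With \<open>\<epsilon> = 1 / (2 * C)\<close> the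
  power of \<open>y\<close> is at most \<open>sqrt (ln X)\<close>, so the exponential grows more
  slowly than any power of \<open>X\<close>.\<close>

definition primes_upto :: "real \<Rightarrow> nat set" where
  "primes_upto x = {p. prime p \<and> real p \<le> x}"

lemma finite_primes_upto [simp, intro]: "finite (primes_upto x)"
proof (rule finite_subset)
  show "primes_upto x \<subseteq> {..nat \<lfloor>x\<rfloor>}" by (auto simp: primes_upto_def le_nat_floor)
qed auto

lemma primes_upto_of_nat: "primes_upto (real n) = {p. prime p \<and> p \<le> n}"
  by (auto simp: primes_upto_def)

lemma primes_upto_floor:
  assumes "x \<ge> 0"
  shows "primes_upto x = primes_upto (real (nat \<lfloor>x\<rfloor>))"
  proof -
  have "real p \<le> x \<longleftrightarrow> real p \<le> real (nat \<lfloor>x\<rfloor>)" for p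
    using assms le_floor_iff[of "int p" x] by (simp add: le_nat_iff) linarith
  then show ?thesis by (simp add: primes_upto_def)
qed

lemma primes_uptoD: "p \<in> primes_upto x \<Longrightarrow> prime p \<and> p \<ge> 2 \<and> p > 0"
  by (auto simp: primes_upto_def prime_ge_2_nat prime_gt_0_nat)

lemma primes_upto_eq_empty: "x < 2 \<Longrightarrow> primes_upto x = {}"
  by (auto simp: primes_upto_def dest!: prime_ge_2_nat)

lemma prod_primes_dvd:
  fixes N :: nat
  assumes "finite S" "\<And>p. p \<in> S \<Longrightarrow> prime p \<and> p dvd N"
  shows "\<Prod>S dvd N"
  using assms
proof (induction S rule: finite_induct)
  case (insert p S)
  have "coprime p (\<Prod>S)"
    using insert by (intro prod_coprime_right) (auto intro!: primes_coprime)
  then show ?case using insert by (auto intro: divides_mult)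
qed auto

text \<open>Chebyshev's argument: the primes in the upper half of the range all divide one binomial
  coefficient, which is at most \<open>2 ^ n\<close>; strong induction deals with the lower
  half.\<close>

lemma sum_ln_primes_le: "(\<Sum>p\<in>primes_upto (real n). ln (real p)) \<le> 4 * ln 2 * real n"
proof (induction n rule: less_induct)
  case (less n)
  show ?case
  proof (cases "n < 2")
    case True
    then have "primes_upto (real n) = {}" by (intro primes_upto_eq_empty) auto
    then show ?thesis by simp
  next
    case False
    \<comment> \<open>Rounding up gives \<open>n - h \<le> h\<close>, so a prime above
      \<open>h\<close> divides neither factorial in the denominator of the binomial
      coefficient.\<close>
    define h where "h = (n+1) div 2"
    have h: "h < n" "2*h \<le> n+1" "n - h \<le> h" "h \<le> n" using False by (auto simp: h_def)
    let ?Q = "{p. prime p \<and> h < p \<and> p \<le> n}"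
    have fin: "finite ?Q" by (rule finite_subset[of _ "{..n}"]) auto
    have "\<Prod>?Q dvd (n choose h)"
    proof (rule prod_primes_dvd[OF fin])
      fix p assume p: "p \<in> ?Q"
      have "p dvd fact n" using p prime_dvd_fact_iff[of p n] by auto
      then have "p dvd fact h * fact (n - h) * (n choose h)"
        by (simp add: binomial_fact_lemma h)
      moreover have "\<not> p dvd fact h" "\<not> p dvd fact (n - h)"
        using p prime_dvd_fact_iff[of p] h by auto
      ultimately show "prime p \<and> p dvd (n choose h)"
        using p by (auto simp: prime_dvd_mult_iff)
    qed
    then have "\<Prod>?Q \<le> (n choose h)" using h by (intro dvd_imp_le) auto
    also have "\<dots> \<le> 2 ^ n" by (rule binomial_le_pow2)
    finally have "real (\<Prod>?Q) \<le> 2 ^ n" by (metis of_nat_le_iff of_nat_numeral of_nat_power)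
    moreover have "real (\<Prod>?Q) > 0" using prime_gt_0_nat by (auto intro!: prod_pos)
    ultimately have "ln (real (\<Prod>?Q)) \<le> ln (2 ^ n)" by (subst ln_le_cancel_iff) auto
    moreover have "ln (real (\<Prod>?Q)) = (\<Sum>p\<in>?Q. ln (real p))"
      unfolding of_nat_prod using prime_gt_0_nat fin by (intro ln_prod) auto
    ultimately have Q: "(\<Sum>p\<in>?Q. ln (real p)) \<le> real n * ln 2" by (simp add: ln_realpow)
    have "primes_upto (real n) = primes_upto (real h) \<union> ?Q"
      using h by (auto simp: primes_upto_of_nat)
    then have "(\<Sum>p\<in>primes_upto (real n). ln (real p)) =
        (\<Sum>p\<in>primes_upto (real h). ln (real p)) + (\<Sum>p\<in>?Q. ln (real p))"
      using fin by (simp add: sum.union_disjoint primes_upto_of_nat disjoint_iff)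
    also have "\<dots> \<le> 4 * ln 2 * real h + real n * ln 2"
      using less.IH[OF h(1)] Q by simp
    also have "\<dots> = ln 2 * real (4 * h + n)" by (simp add: algebra_simps)
    \<comment> \<open>Here \<open>4 * h \<le> 2 * n + 2 \<le> 3 * n\<close>, since
      \<open>2 * h \<le> n + 1\<close> and \<open>n \<ge> 2\<close>.\<close>
    also have "\<dots> \<le> ln 2 * real (4 * n)"
      using h False by (intro mult_left_mono) auto
    finally show ?thesis by simp
  qed
qed

lemma real_div_le: "real (n div d) \<le> real n / real d"
  using floor_divide_of_nat_eq[of n d, where ?'a = real] by linarith

lemma real_div_ge: "real n / real d - 1 \<le> real (n div d)"
  using floor_divide_of_nat_eq[of n d, where ?'a = real] by linarith

lemma multiples_upto_eq_image:
  fixes d :: nat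
  assumes "d > 0"
  shows "{m \<in> {1..n}. d dvd m} = (\<lambda>k. d * k) ` {1..n div d}"
proof (intro equalityI subsetI)
  fix m assume "m \<in> {m \<in> {1..n}. d dvd m}"
  then obtain k where "m = d * k" "m \<ge> 1" "m \<le> n" by (auto elim: dvdE)
  moreover from this have "k \<le> n div d" using assms
    by (metis div_le_mono nonzero_mult_div_cancel_left not_gr_zero)
  ultimately show "m \<in> (\<lambda>k. d * k) ` {1..n div d}" using assms by (auto intro!: imageI)
next
  fix m assume "m \<in> (\<lambda>k. d * k) ` {1..n div d}"
  then obtain k where k: "m = d * k" "k \<ge> 1" "k \<le> n div d" by (auto simp only: image_iff atLeastAtMost_iff)
  have "d * k \<le> d * (n div d)" using k by simp
  also have "\<dots> \<le> n" by simp
  finally show "m \<in> {m \<in> {1..n}. d dvd m}" using k assms by auto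
qed

lemma card_multiples_upto:
  fixes d :: nat
  assumes "d > 0"
  shows "card {m \<in> {1..n}. d dvd m} = n div d"
  unfolding multiples_upto_eq_image[OF assms] using assms
  by (subst card_image) (auto simp: inj_on_def)

text \<open>Legendre's formula in logarithmic form: write each \<open>ln m\<close> as a divisor sum
  of \<open>mangoldt\<close> and exchange the summations.\<close>

lemma ln_fact_eq_sum_mangoldt:
  "ln (fact n) = (\<Sum>d\<in>{1..n}. mangoldt d * real (n div d))"
proof -
  have "ln (fact n) = (\<Sum>m\<in>{1..n}. ln (real m))"
    by (simp add: fact_prod) (subst ln_prod, auto)
  also have "\<dots> = (\<Sum>m\<in>{1..n}. \<Sum>d | d dvd m. mangoldt d)"
    by (intro sum.cong) (auto simp: mangoldt_sum)
  also have "\<dots> = (\<Sum>m\<in>{1..n}. \<Sum>d\<in>{d\<in>{1..n}. d dvd m}. mangoldt d)"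
    by (intro sum.cong refl) (auto dest: dvd_imp_le dvd_pos_nat simp: Suc_le_eq)
  also have "\<dots> = (\<Sum>d\<in>{1..n}. \<Sum>m\<in>{m\<in>{1..n}. d dvd m}. mangoldt d)"
    by (rule sum.swap_restrict) auto
  also have "\<dots> = (\<Sum>d\<in>{1..n}. mangoldt d * real (n div d))"
    by (intro sum.cong refl) (subst sum_constant, subst card_multiples_upto, auto)
  finally show ?thesis .
qed

lemma ln_fact_upper: "ln (fact n :: real) \<le> real n * ln (real n)"
proof (cases "n = 0")
  case False
  have "ln (fact n :: real) \<le> ln (real n ^ n)"
    using False fact_le_power[of n, where ?'a = real] by (subst ln_le_cancel_iff) auto
  then show ?thesis using False by (simp add: ln_realpow)
qed auto

text \<open>A weak form of Stirling's formula. An error of order \<open>n\<close> is harmless,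
  because Mertens' first theorem divides by \<open>n\<close>.\<close>

lemma ln_fact_lower: "real n * ln (real n) - real n \<le> ln (fact n :: real)"
proof (induction n)
  case (Suc n)
  show ?case
  proof (cases "n = 0")
    case False
    have "ln (real (Suc n)) - ln (real n) = ln (1 + 1 / real n)"
      using False ln_div[of "real (Suc n)" "real n"] by (simp add: add_divide_distrib add.commute)
    also have "\<dots> \<le> 1 / real n" using False by (intro ln_add_one_self_le_self) auto
    finally have "real n * (ln (real (Suc n)) - ln (real n)) \<le> 1" using False
      by (simp add: field_simps)
    moreover have "ln (fact (Suc n) :: real) = ln (real (Suc n)) + ln (fact n)"
      by (simp add: ln_mult del: of_nat_Suc)
    ultimately show ?thesis using Suc by (simp add: algebra_simps)
  qed auto
qed auto

lemma ln_le_two_sqrt: "x > 0 \<Longrightarrow> ln x \<le> 2 * sqrt (x::real)"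
  using ln_less_self[of "sqrt x"] by (simp add: ln_sqrt)

lemma sum_powers_from_2_le:
  fixes p :: real
  assumes "p \<ge> 2"
  shows "(\<Sum>k\<in>{2..n}. 1 / p ^ k) \<le> 2 / p ^ 2"
proof -
  have "(\<Sum>k\<in>{2..n}. 1 / p ^ k) \<le> 1 / (p * (p - 1)) - (if n < 2 then 0 else 1 / (p ^ n * (p - 1)))"
  proof (induction n)
    case (Suc n)
    consider "n = 0" | "n = 1" | "n \<ge> 2" by linarith
    then show ?case
    proof cases
      case 3
      then have "{2..Suc n} = insert (Suc n) {2..n}" by auto
      moreover have "1 / p ^ Suc n = 1 / (p ^ n * (p - 1)) - 1 / (p ^ Suc n * (p - 1))"
        using assms by (simp add: divide_simps)
      ultimately show ?thesis using 3 Suc by simp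
    next
      case 2
      have "1 / p\<^sup>2 = 1 / (p * (p - 1)) - 1 / (p\<^sup>2 * (p - 1))"
        using assms by (simp add: divide_simps power2_eq_square)
      then show ?thesis using 2 by (simp add: numeral_2_eq_2)
    qed (use assms in auto)
  qed (use assms in auto)
  also have "\<dots> \<le> 1 / (p * (p - 1))" using assms by auto
  also have "\<dots> \<le> 2 / p ^ 2" using assms by (simp add: field_simps power2_eq_square)
  finally show ?thesis .
qed

text \<open>Both bounds come from evaluating \<open>ln (fact n)\<close> in two ways. Replacing
  \<open>n div p\<close> by \<open>n / p\<close> costs a Chebyshev sum, which is O(n); the proper
  prime powers contribute a bounded amount after division by \<open>n\<close>.\<close>

lemma Mertens_first_bounds:
  obtains K where "\<And>n. n \<ge> 1 \<Longrightarrow> \<bar>(\<Sum>p\<in>primes_upto (real n). ln (real p) / real p) - ln (real n)\<bar> \<le> K"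
proof -
  define K1 where "K1 = 4 * (\<Sum>n. real n powr (-3/2))"
  have sm: "summable (\<lambda>n. real n powr (-3/2))" by (simp add: summable_real_powr_iff)
  have K1: "K1 \<ge> 0" unfolding K1_def using sm by (intro mult_nonneg_nonneg suminf_nonneg) auto
  have bd: "\<bar>(\<Sum>p\<in>primes_upto (real n). ln (real p) / real p) - ln (real n)\<bar> \<le> 4 * ln 2 + 1 + K1"
    if n: "n \<ge> 1" for n
  proof -
    let ?P = "primes_upto (real n)"
    let ?S = "\<Sum>p\<in>?P. ln (real p) / real p"
    have upper: "?S \<le> ln (real n) + 4 * ln 2"
    proof -
      have "real n * ?S - (\<Sum>p\<in>?P. ln (real p)) = (\<Sum>p\<in>?P. ln (real p) * (real n / real p - 1))"
        by (simp add: sum_distrib_left sum_subtractf algebra_simps)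
      also have "\<dots> \<le> (\<Sum>p\<in>?P. mangoldt p * real (n div p))"
      proof (rule sum_mono)
        fix p assume p: "p \<in> ?P"
        show "ln (real p) * (real n / real p - 1) \<le> mangoldt p * real (n div p)"
          using primes_uptoD[OF p] real_div_ge[of n p] by (auto intro!: mult_left_mono)
      qed
      also have "\<dots> \<le> (\<Sum>d\<in>{1..n}. mangoldt d * real (n div d))"
        by (rule sum_mono2) (auto simp: primes_upto_of_nat prime_ge_1_nat mangoldt_nonneg dest: prime_gt_0_nat)
      also have "\<dots> \<le> real n * ln (real n)"
        using ln_fact_upper[of n] by (simp add: ln_fact_eq_sum_mangoldt)
      finally have "real n * ?S \<le> real n * (ln (real n) + 4 * ln 2)"
        using sum_ln_primes_le[of n] by (simp add: algebra_simps)
      then show ?thesis using n by simp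
    qed
    have lower: "ln (real n) - 1 \<le> ?S + K1"
    proof -
      have "real n * (ln (real n) - 1) \<le> (\<Sum>d\<in>{1..n}. mangoldt d * real (n div d))"
        using ln_fact_lower[of n] by (simp add: ln_fact_eq_sum_mangoldt algebra_simps)
      also have "\<dots> \<le> (\<Sum>d\<in>{1..n}. real n * (mangoldt d / real d))"
      proof (rule sum_mono)
        fix d assume "d \<in> {1..n}"
        show "mangoldt d * real (n div d) \<le> real n * (mangoldt d / real d)"
          using mult_left_mono[OF real_div_le[of n d] mangoldt_nonneg[of d]] by (simp add: mult.commute)
      qed
      also have "\<dots> = real n * (\<Sum>d\<in>{1..n}. mangoldt d / real d)" by (simp add: sum_distrib_left)
      finally have "ln (real n) - 1 \<le> (\<Sum>d\<in>{1..n}. mangoldt d / real d)"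
        using n by simp
      also have "\<dots> = (\<Sum>d\<in>{d\<in>{1..n}. primepow d}. mangoldt d / real d)"
        by (intro sum.mono_neutral_right) (auto simp: mangoldt_def)
      \<comment> \<open>A prime power \<open>p ^ k \<le> n\<close> has
        \<open>k < 2 ^ k \<le> n\<close>, so this rectangle of pairs covers all of them; the surplus
        pairs only increase an upper bound.\<close>
      also have "\<dots> \<le> (\<Sum>(p,k)\<in>?P \<times> {1..n}. ln (real p) / real p ^ k)"
      proof (rule sum_le_included[where i = "\<lambda>(p,k). p ^ k"])
        show "\<forall>y\<in>?P \<times> {1..n}. 0 \<le> (case y of (p, k) \<Rightarrow> ln (real p) / real p ^ k)"
          by (auto dest!: primes_uptoD)
        show "\<forall>x\<in>{d \<in> {1..n}. primepow d}. \<exists>y\<in>?P \<times> {1..n}.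
           (case y of (p, k) \<Rightarrow> p ^ k) = x \<and>
           mangoldt x / real x \<le> (case y of (p, k) \<Rightarrow> ln (real p) / real p ^ k)"
        proof
          fix d assume d: "d \<in> {d \<in> {1..n}. primepow d}"
          then obtain p k where pk: "prime p" "k > 0" "d = p ^ k" by (auto simp: primepow_def)
          have "p \<le> d" using pk prime_gt_0_nat[of p] self_le_power[of p k] by auto
          moreover have "k < 2 ^ k" by simp
          moreover have "2 ^ k \<le> d" unfolding pk(3) using pk prime_ge_2_nat by (intro power_mono) auto
          ultimately have "p \<le> n" "k \<le> n" using d unfolding mem_Collect_eq atLeastAtMost_iff by linarith+
          then have "(p, k) \<in> ?P \<times> {1..n}" using pk by (auto simp: primes_upto_of_nat)
          then show "\<exists>y\<in>?P \<times> {1..n}. (case y of (p, k) \<Rightarrow> p ^ k) = d \<and>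
              mangoldt d / real d \<le> (case y of (p, k) \<Rightarrow> ln (real p) / real p ^ k)"
            using pk by (intro bexI[of _ "(p, k)"]) auto
        qed
      qed auto
      also have "\<dots> = (\<Sum>p\<in>?P. \<Sum>k\<in>{1..n}. ln (real p) / real p ^ k)"
        by (simp add: sum.cartesian_product)
      also have "\<dots> \<le> (\<Sum>p\<in>?P. ln (real p) / real p + 4 * real p powr (-3/2))"
      proof (rule sum_mono)
        fix p assume p: "p \<in> ?P"
        have p2: "real p \<ge> 2" using primes_uptoD[OF p] by linarith
        have "{1..n} = insert 1 {2..n}" using n by auto
        then have "(\<Sum>k\<in>{1..n}. ln (real p) / real p ^ k) =
            ln (real p) / real p + ln (real p) * (\<Sum>k\<in>{2..n}. 1 / real p ^ k)"
          by (simp add: sum_distrib_left)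
        \<comment> \<open>Trading \<open>ln p\<close> for \<open>2 * sqrt p\<close> leaves
          \<open>4 * p powr (-3/2)\<close>, whose sum over all integers converges and defines
          \<open>K1\<close>.\<close>
        also have "ln (real p) * (\<Sum>k\<in>{2..n}. 1 / real p ^ k) \<le> (2 * sqrt (real p)) * (2 / real p ^ 2)"
          using p2 by (intro mult_mono ln_le_two_sqrt sum_powers_from_2_le) (auto intro: sum_nonneg)
        also have "sqrt (real p) * (1 / real p ^ 2) = real p powr (1/2) * real p powr (-2)"
          using p2 by (simp add: powr_half_sqrt powr_minus powr_numeral field_simps)
        then have "(2 * sqrt (real p)) * (2 / real p ^ 2) = 4 * real p powr (-3/2)"
          by (simp add: powr_add[symmetric])
        finally show "(\<Sum>k\<in>{1..n}. ln (real p) / real p ^ k) \<le>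
            ln (real p) / real p + 4 * real p powr (-3/2)" by simp
      qed
      also have "\<dots> = ?S + 4 * (\<Sum>p\<in>?P. real p powr (-3/2))"
        by (simp add: sum.distrib sum_distrib_left)
      also have "\<dots> \<le> ?S + K1"
        unfolding K1_def using sum_le_suminf[OF sm, of ?P] by auto
      finally show ?thesis .
    qed
    have "ln (2::real) > 0" by simp
    then show ?thesis using upper lower K1 unfolding abs_le_iff by linarith
  qed
  then show ?thesis using that by blast
qed

lemma harm_le_one_plus_ln: "n \<ge> 1 \<Longrightarrow> harm n \<le> 1 + ln (real n)"
  using euler_mascheroni_sequence_decreasing[of 1 n] by (simp add: harm_def)

subsection \<open>Mertens' second theorem\<close>

text \<open>Summation by parts: the boundary term tends to 0, and the remaining series is dominated
  by \<open>K\<close> times the telescoping series of the differences of \<open>b\<close>.\<close>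

lemma Dirichlet_test_real:
  fixes a b :: "nat \<Rightarrow> real"
  assumes bd: "\<And>n. \<bar>\<Sum>k<n. a k\<bar> \<le> K" and b: "decseq b" "b \<longlonglongrightarrow> 0"
  shows "summable (\<lambda>n. a n * b n)"
proof -
  define S where "S n = (\<Sum>k<n. a k)" for n
  have abel: "(\<Sum>k<n. a k * b k) = S n * b n + (\<Sum>k<n. S (Suc k) * (b k - b (Suc k)))" for n
    by (induction n) (auto simp: S_def algebra_simps)
  have "(\<lambda>n. S n * b n) \<longlonglongrightarrow> 0"
  proof (rule tendsto_rabs_zero_cancel, rule tendsto_sandwich[OF _ _ tendsto_const])
    show "(\<lambda>n. K * \<bar>b n\<bar>) \<longlonglongrightarrow> 0"
      using tendsto_mult_right_zero[OF tendsto_rabs_zero[OF b(2)]] .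
    show "\<forall>\<^sub>F n in sequentially. \<bar>S n * b n\<bar> \<le> K * \<bar>b n\<bar>"
      using bd by (auto simp: abs_mult S_def intro!: mult_right_mono always_eventually)
  qed auto
  moreover have "summable (\<lambda>k. S (Suc k) * (b k - b (Suc k)))"
  proof (rule summable_comparison_test)
    show "summable (\<lambda>k. K * (b k - b (Suc k)))"
      using telescope_summable'[OF b(2)] by (rule summable_mult)
    show "\<exists>N. \<forall>n\<ge>N. norm (S (Suc n) * (b n - b (Suc n))) \<le> K * (b n - b (Suc n))"
    proof (intro exI allI impI)
      fix n
      have "b (Suc n) \<le> b n" using b(1) by (simp add: decseq_Suc_iff)
      then show "norm (S (Suc n) * (b n - b (Suc n))) \<le> K * (b n - b (Suc n))"
        using bd[of "Suc n"] unfolding S_def by (simp add: abs_mult mult_right_mono del: sum.lessThan_Suc)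
    qed
  qed
  ultimately have "convergent (\<lambda>n. \<Sum>k<n. a k * b k)"
    unfolding abel by (intro convergent_add) (auto simp: convergentI summable_iff_convergent)
  then show ?thesis by (simp add: summable_iff_convergent)
qed

lemma primes_upto_Suc:
  "primes_upto (real (Suc n)) = (if prime (Suc n) then insert (Suc n) else id) (primes_upto (real n))"
  unfolding primes_upto_of_nat by (auto simp: le_Suc_eq)

lemma Suc_notin_primes_upto: "Suc n \<notin> primes_upto (real n)"
  by (auto simp: primes_upto_of_nat)

text \<open>Let \<open>R\<close> be the bounded remainder in the first theorem. An increment of the
  prime sum is the increment of \<open>R\<close> divided by \<open>ln\<close>, which sums by
  Dirichlet's test, plus the increment of \<open>ln\<close> divided by \<open>ln\<close>, which
  differs from that of \<open>ln (ln n)\<close> by a summable amount.\<close>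

lemma Mertens_second:
  obtains B where "(\<lambda>n. (\<Sum>p\<in>primes_upto (real n). 1 / real p) - ln (ln (real n))) \<longlonglongrightarrow> B"
proof -
  obtain K where K: "\<And>n. n \<ge> 1 \<Longrightarrow> \<bar>(\<Sum>p\<in>primes_upto (real n). ln (real p) / real p) - ln (real n)\<bar> \<le> K"
    using Mertens_first_bounds by blast
  define R where "R n = (\<Sum>p\<in>primes_upto (real n). ln (real p) / real p) - ln (real n)" for n
  define A where "A n = (\<Sum>p\<in>primes_upto (real n). 1 / real p)" for n
  \<comment> \<open>The shift starts the sequence at 2, the first integer whose logarithm is
    positive.\<close>
  define f where "f k = A (k + 2) - ln (ln (real (k + 2)))" for k
  define a where "a k = R (k + 3) - R (k + 2)" for k
  define b where "b k = 1 / ln (real (k + 3))" for k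
  define c where "c k = (ln (real (k + 3)) - ln (real (k + 2))) / ln (real (k + 3)) -
      (ln (ln (real (k + 3))) - ln (ln (real (k + 2))))" for k
  have "A (Suc n) - A n = (R (Suc n) - R n) / ln (real (Suc n)) +
      (ln (real (Suc n)) - ln (real n)) / ln (real (Suc n))" if "n \<ge> 1" for n
  proof -
    have "ln (real (Suc n)) > 0" using that by simp
    then show ?thesis
      unfolding A_def R_def using Suc_notin_primes_upto[of n]
      by (simp add: primes_upto_Suc diff_divide_distrib add_divide_distrib del: of_nat_Suc)
  qed
  from this[of "k + 2" for k] have step: "f (Suc k) - f k = a k * b k + c k" for k
    by (simp add: f_def a_def b_def c_def eval_nat_numeral algebra_simps diff_divide_distrib)
  have "summable (\<lambda>k. a k * b k)"
  proof (rule Dirichlet_test_real)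
    fix n
    have "(\<Sum>k<n. a k) = R (n + 2) - R 2"
      by (induction n) (auto simp: a_def eval_nat_numeral)
    then show "\<bar>\<Sum>k<n. a k\<bar> \<le> 2 * K"
      using K[of "n + 2"] K[of 2] unfolding R_def by linarith
  next
    show "decseq b" unfolding b_def decseq_Suc_iff by (auto intro!: divide_left_mono)
    show "b \<longlonglongrightarrow> 0" unfolding b_def by real_asymp
  qed
  moreover have "summable c"
  proof (rule summable_comparison_test)
    have "(\<lambda>k. 1 / ln (real (k + 2))) \<longlonglongrightarrow> 0" by real_asymp
    from telescope_summable'[OF this]
    show "summable (\<lambda>k. 1 / ln (real (k + 2)) - 1 / ln (real (k + 3)))"
      by (simp add: eval_nat_numeral)
    show "\<exists>N. \<forall>k\<ge>N. norm (c k) \<le> 1 / ln (real (k + 2)) - 1 / ln (real (k + 3))"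
    proof (intro exI allI impI)
      fix k
      \<comment> \<open>Two uses of \<open>ln t \<le> t - 1\<close> enclose
        \<open>ln v - ln u\<close> between \<open>(v - u) / v\<close> and
        \<open>(v - u) / u\<close>. As \<open>v - u \<le> 1\<close>, the gap is at most
        \<open>1 / u - 1 / v\<close>, which telescopes.\<close>
      define u v where "u = ln (real (k + 2))" and "v = ln (real (k + 3))"
      have uv: "0 < u" "u < v" by (auto simp: u_def v_def)
      have "v - u = ln (1 + 1 / real (k + 2))"
        using ln_div[of "real (k + 3)" "real (k + 2)"]
        unfolding u_def v_def by (simp add: field_simps)
      also have "\<dots> \<le> 1 / real (k + 2)" by (intro ln_add_one_self_le_self) auto
      also have "\<dots> \<le> 1" by simp
      finally have vu: "v - u \<le> 1" .
      have "ln v - ln u = ln (v / u)" using uv by (simp add: ln_div)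
      also have "\<dots> \<le> v / u - 1" using uv by (intro ln_le_minus_one) auto
      finally have 1: "ln v - ln u \<le> (v - u) / u" using uv by (simp add: diff_divide_distrib)
      have "ln u - ln v = ln (u / v)" using uv by (simp add: ln_div)
      also have "\<dots> \<le> u / v - 1" using uv by (intro ln_le_minus_one) auto
      finally have 2: "(v - u) / v \<le> ln v - ln u" using uv by (simp add: diff_divide_distrib)
      have "(v - u) / u - (v - u) / v = (v - u) * (1 / u - 1 / v)"
        by (simp add: algebra_simps)
      also have "\<dots> \<le> 1 * (1 / u - 1 / v)"
        using vu uv by (intro mult_right_mono) (auto simp: field_simps)
      finally have 3: "(v - u) / u - (v - u) / v \<le> 1 / u - 1 / v" by simp
      have "c k = (v - u) / v - (ln v - ln u)" by (simp add: c_def u_def v_def)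
      with 1 2 3 have "\<bar>c k\<bar> \<le> 1 / u - 1 / v" by linarith
      then show "norm (c k) \<le> 1 / ln (real (k + 2)) - 1 / ln (real (k + 3))"
        by (simp add: u_def v_def)
    qed
  qed
  ultimately have "summable (\<lambda>k. f (Suc k) - f k)" unfolding step by (rule summable_add)
  then have "convergent (\<lambda>n. f n - f 0)"
    by (simp add: summable_iff_convergent sum_lessThan_telescope)
  then have "convergent f" using convergent_add[OF _ convergent_const[of "f 0"]] by fastforce
  then obtain B where "f \<longlonglongrightarrow> B" by (auto simp: convergent_def)
  then have "(\<lambda>n. A n - ln (ln (real n))) \<longlonglongrightarrow> B"
    unfolding f_def by (rule LIMSEQ_offset)
  then show ?thesis using that unfolding A_def by blast
qed

subsection \<open>The zeta function to the right of 1 and an Abelian theorem\<close>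

text \<open>Riemann's zeta function for \<sigma> > 1: the index may start at 0 because
  \<open>0 powr (-\<sigma>)\<close> is 0.\<close>

definition real_zeta :: "real \<Rightarrow> real" where
  "real_zeta \<sigma> = (\<Sum>n. real n powr (-\<sigma>))"

text \<open>Mean value theorem for \<open>t powr (-s)\<close> on \<open>[n, n + 1]\<close>, whose
  derivative is monotone in absolute value.\<close>

lemma powr_diff_bounds:
  fixes s :: real and n :: nat
  assumes "s > 0" "n \<ge> 1"
  shows "real n powr (-s) - real (Suc n) powr (-s) \<le> s * real n powr (-(1 + s))"
    and "s * real (Suc n) powr (-(1 + s)) \<le> real n powr (-s) - real (Suc n) powr (-s)"
proof -
  have exponent: "-s - 1 = -(1 + s)" by simp
  have "\<exists>z. real n < z \<and> z < real (Suc n) \<and> real (Suc n) powr (-s) - real n powr (-s) =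
      (real (Suc n) - real n) * (-s * z powr (-s - 1))"
    using assms by (intro MVT2) (use has_real_derivative_powr[of _ "-s"] in auto)
  then obtain z where z: "real n < z" "z < real (Suc n)"
    "real n powr (-s) - real (Suc n) powr (-s) = s * z powr (-(1 + s))"
    unfolding exponent by (auto simp: algebra_simps)
  have "z powr (-(1 + s)) \<le> real n powr (-(1 + s))"
    using z assms by (intro powr_mono2') auto
  then show "real n powr (-s) - real (Suc n) powr (-s) \<le> s * real n powr (-(1 + s))"
    unfolding z(3) using assms by (intro mult_left_mono) auto
  have "real (Suc n) powr (-(1 + s)) \<le> z powr (-(1 + s))"
    using z assms by (intro powr_mono2') auto
  then show "s * real (Suc n) powr (-(1 + s)) \<le> real n powr (-s) - real (Suc n) powr (-s)"
    unfolding z(3) using assms by (intro mult_left_mono) auto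
qed

lemma real_zeta_sums:
  assumes "\<sigma> > 1"
  shows "(\<lambda>n. real n powr (-\<sigma>)) sums real_zeta \<sigma>"
  unfolding real_zeta_def using assms by (intro summable_sums) (simp add: summable_real_powr_iff)

text \<open>Summing the preceding bounds telescopes to 1. This replaces the statement that zeta has
  a simple pole of residue 1 at 1.\<close>

lemma real_zeta_bounds:
  assumes "s > 0"
  shows "1 \<le> s * real_zeta (1 + s)" "s * real_zeta (1 + s) \<le> s + 1"
proof -
  have z: "(\<lambda>n. real (n + 1) powr (-(1 + s))) sums (real_zeta (1 + s))"
    using real_zeta_sums[of "1 + s"] assms by (subst sums_iff_shift) auto
  have "(\<lambda>n. real (n + 1) powr (-s)) \<longlonglongrightarrow> 0" using assms by real_asymp
  from telescope_sums'[OF this]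
  have t: "(\<lambda>n. real (n + 1) powr (-s) - real (Suc (n + 1)) powr (-s)) sums 1"
    by (simp add: algebra_simps)
  show "1 \<le> s * real_zeta (1 + s)"
    using powr_diff_bounds(1)[OF assms, of "n + 1" for n]
    by (intro sums_le[OF _ t sums_mult[OF z]]) simp
  \<comment> \<open>The second bound involves \<open>Suc n\<close>, so the series starts at 2 and
    the term of index 1 is split off.\<close>
  have z': "(\<lambda>n. real (n + 2) powr (-(1 + s))) sums (real_zeta (1 + s) - 1)"
    using z sums_iff_shift[of "\<lambda>n. real (n + 1) powr (-(1 + s))" 1 "real_zeta (1 + s) - 1"]
    by (simp add: add_ac)
  have "s * (real_zeta (1 + s) - 1) \<le> 1"
    using powr_diff_bounds(2)[OF assms, of "n + 1" for n] 
    by (intro sums_le[OF _ sums_mult[OF z'] t]) (auto simp: add_ac)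
  then show "s * real_zeta (1 + s) \<le> s + 1" by (simp add: algebra_simps)
qed

text \<open>Induction on \<open>S\<close>: the numbers that survive \<open>S\<close> split into
  those that also survive \<open>p\<close> and the \<open>p\<close>-fold multiples of survivors of
  \<open>S\<close>, whose sum carries the factor \<open>p powr (-\<sigma>)\<close>.\<close>

lemma sieved_zeta:
  assumes \<sigma>: "\<sigma> > 1" and S: "finite S" "\<And>p. p \<in> S \<Longrightarrow> prime p"
  shows "infsum (\<lambda>n. real n powr (-\<sigma>)) {n. \<forall>p\<in>S. \<not> p dvd n} =
           real_zeta \<sigma> * (\<Prod>p\<in>S. 1 - real p powr (-\<sigma>))"
proof -
  let ?f = "\<lambda>n. real n powr (-\<sigma>)"
  have hs: "(?f has_sum real_zeta \<sigma>) UNIV"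
    using real_zeta_sums[OF \<sigma>] by (intro norm_summable_imp_has_sum) (auto simp: sums_iff)
  then have so: "?f summable_on A" for A :: "nat set"
    using summable_on_subset_banach[of ?f UNIV A] by (auto simp: summable_on_def)
  show ?thesis using S
  proof (induction S rule: finite_induct)
    case empty
    then show ?case using hs by (simp add: infsumI)
  next
    case (insert p S)
    let ?U = "{n. \<forall>q\<in>S. \<not> q dvd n}" and ?V = "{n. \<forall>q\<in>insert p S. \<not> q dvd n}"
    have "prime p" using insert by auto
    then have p: "p > 0" by (simp add: prime_gt_0_nat)
    have dvd: "q dvd p * m \<longleftrightarrow> q dvd m" if "q \<in> S" for q m
    proof -
      have "prime q" "q \<noteq> p" using insert that by auto
      then have "coprime q p" using \<open>prime p\<close> by (intro primes_coprime)
      then show ?thesis by (simp add: coprime_dvd_mult_right_iff)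
    qed
    have "?U = ?V \<union> (\<lambda>m. p * m) ` ?U"
    proof (intro equalityI subsetI)
      fix n assume n: "n \<in> ?U"
      show "n \<in> ?V \<union> (\<lambda>m. p * m) ` ?U"
      proof (cases "p dvd n")
        case True
        then obtain m where m: "n = p * m" by (elim dvdE)
        with n dvd have "m \<in> ?U" by auto
        with m show ?thesis by blast
      qed (use n in auto)
    qed (use dvd in auto)
    moreover have "?V \<inter> (\<lambda>m. p * m) ` ?U = {}" by auto
    ultimately have "infsum ?f ?U = infsum ?f ?V + infsum ?f ((\<lambda>m. p * m) ` ?U)"
      using infsum_Un_disjoint[OF so so, of ?V "(\<lambda>m. p * m) ` ?U"] by simp
    also have "infsum ?f ((\<lambda>m. p * m) ` ?U) = infsum (\<lambda>m. real p powr (-\<sigma>) * ?f m) ?U"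
      using p by (subst infsum_reindex) (auto simp: inj_on_def o_def powr_mult)
    also have "\<dots> = real p powr (-\<sigma>) * infsum ?f ?U" by (rule infsum_cmult_right) (rule so)
    finally have "infsum ?f ?V = infsum ?f ?U * (1 - real p powr (-\<sigma>))" by (simp add: algebra_simps)
    then show ?case using insert by (simp add: mult_ac)
  qed
qed

text \<open>After sieving by all primes up to \<open>N\<close> only 1 and integers above
  \<open>N\<close> contribute, so the sieved sum lies between 1 and 1 plus a tail of the zeta
  series.\<close>

lemma real_zeta_Euler_product:
  assumes \<sigma>: "\<sigma> > 1"
  shows "(\<lambda>N. real_zeta \<sigma> * (\<Prod>p\<in>primes_upto (real N). 1 - real p powr (-\<sigma>))) \<longlonglongrightarrow> 1"
proof (rule tendsto_sandwich)
  let ?f = "\<lambda>n. real n powr (-\<sigma>)"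
  let ?U = "\<lambda>N. {n. \<forall>p\<in>primes_upto (real N). \<not> p dvd n}"
  have hs: "(?f has_sum real_zeta \<sigma>) UNIV"
    using real_zeta_sums[OF \<sigma>] by (intro norm_summable_imp_has_sum) (auto simp: sums_iff)
  then have so: "?f summable_on A" for A :: "nat set"
    using summable_on_subset_banach[of ?f UNIV A] by (auto simp: summable_on_def)
  have eq: "real_zeta \<sigma> * (\<Prod>p\<in>primes_upto (real N). 1 - real p powr (-\<sigma>)) = infsum ?f (?U N)" for N
    by (rule sieved_zeta[OF \<sigma> finite_primes_upto, symmetric]) (simp add: primes_upto_def)
  have "sum ?f {1} \<le> infsum ?f (?U N)" for N
    by (intro finite_sum_le_infsum so) (auto simp: primes_upto_def)
  then show "\<forall>\<^sub>F N in sequentially. 1 \<le> real_zeta \<sigma> * (\<Prod>p\<in>primes_upto (real N). 1 - real p powr (-\<sigma>))"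
    unfolding eq by auto
  have "infsum ?f (?U N) \<le> 1 + (real_zeta \<sigma> - (\<Sum>n<Suc N. ?f n))" if N: "N \<ge> 1" for N
  proof -
    have sub: "n \<in> {0, 1} \<union> {Suc N..}" if "n \<in> ?U N" for n
    proof (rule ccontr)
      assume "n \<notin> {0, 1} \<union> {Suc N..}"
      then have n: "n > 1" "n \<le> N" by auto
      then obtain p where "prime p" "p dvd n" using prime_factor_nat[of n] by auto
      moreover have "p \<le> N" using n \<open>p dvd n\<close> dvd_imp_le[of p n] by linarith
      ultimately show False using that by (auto simp: primes_upto_of_nat)
    qed
    have "infsum ?f (?U N) \<le> infsum ?f ({0, 1} \<union> {Suc N..})"
      using sub by (intro infsum_mono_neutral so) auto
    also have "\<dots> \<le> infsum ?f {0, 1} + infsum ?f {Suc N..}"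
      using N by (subst infsum_Un_disjoint[OF so so]) auto
    also have "infsum ?f {0, 1} = 1" by simp
    also have "infsum ?f {Suc N..} = real_zeta \<sigma> - (\<Sum>n<Suc N. ?f n)"
    proof -
      have "(UNIV :: nat set) = {..<Suc N} \<union> {Suc N..}" by auto
      then have "infsum ?f UNIV = infsum ?f {..<Suc N} + infsum ?f {Suc N..}"
        using infsum_Un_disjoint[OF so so, of "{..<Suc N}" "{Suc N..}"] by (simp add: disjoint_iff)
      then show ?thesis using infsumI[OF hs] by simp
    qed
    finally show ?thesis .
  qed
  then show "\<forall>\<^sub>F N in sequentially. real_zeta \<sigma> * (\<Prod>p\<in>primes_upto (real N). 1 - real p powr (-\<sigma>)) \<le>
      1 + (real_zeta \<sigma> - (\<Sum>n<Suc N. ?f n))"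
    unfolding eq using eventually_ge_at_top[of 1] by (rule eventually_mono[rotated])
  have "(\<lambda>N. \<Sum>n<Suc N. ?f n) \<longlonglongrightarrow> real_zeta \<sigma>"
    using real_zeta_sums[OF \<sigma>] unfolding sums_def by (rule LIMSEQ_Suc)
  then have "(\<lambda>N. 1 + (real_zeta \<sigma> - (\<Sum>n<Suc N. ?f n))) \<longlonglongrightarrow> 1 + (real_zeta \<sigma> - real_zeta \<sigma>)"
    by (intro tendsto_intros)
  then show "(\<lambda>N. 1 + (real_zeta \<sigma> - (\<Sum>n<Suc N. ?f n))) \<longlonglongrightarrow> 1" by simp
qed auto

text \<open>The weights \<open>(1 - x) * x ^ n\<close> have total mass 1, and as \<open>x\<close>
  tends to 1 the mass of any fixed initial segment vanishes, so the weighted mean of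
  \<open>D\<close> is governed by its limit.\<close>

lemma Abelian_mean:
  fixes D :: "nat \<Rightarrow> real"
  assumes "D \<longlonglongrightarrow> c"
  shows "((\<lambda>x. (1 - x) * (\<Sum>n. D n * x ^ n)) \<longlongrightarrow> c) (at_left 1)"
proof (rule tendstoI)
  fix e :: real assume e: "e > 0"
  obtain K where K: "\<And>n. \<bar>D n\<bar> \<le> K"
    using convergent_imp_Bseq[of D] assms by (auto simp: convergentI Bseq_def)
  have sm: "summable (\<lambda>n. \<bar>D n - d\<bar> * x ^ n)" if "0 < x" "x < 1" for x d
  proof (rule summable_comparison_test)
    show "summable (\<lambda>n. (K + \<bar>d\<bar>) * x ^ n)" using that by (intro summable_mult summable_geometric) auto
    have "\<bar>D n - d\<bar> \<le> K + \<bar>d\<bar>" for n using K[of n] by linarith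
    then show "\<exists>N. \<forall>n\<ge>N. norm (\<bar>D n - d\<bar> * x ^ n) \<le> (K + \<bar>d\<bar>) * x ^ n"
      using that by (auto simp: abs_mult intro!: mult_right_mono)
  qed
  obtain N where N: "\<And>n. n \<ge> N \<Longrightarrow> \<bar>D n - c\<bar> < e / 2"
    using assms e unfolding LIMSEQ_iff by (metis half_gt_zero real_norm_def)
  define H where "H = (\<Sum>n<N. \<bar>D n - c\<bar>)"
  have bd: "\<bar>(1 - x) * (\<Sum>n. D n * x ^ n) - c\<bar> \<le> (1 - x) * H + e / 2" if x: "0 < x" "x < 1" for x
  proof -
    have sums: "(\<lambda>n. x ^ n) sums (1 / (1 - x))" using x by (intro geometric_sums) auto
    have smc: "summable (\<lambda>n. (D n - d) * x ^ n)" for d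
      using sm[OF x, of d] x summable_rabs_cancel[of "\<lambda>n. (D n - d) * x ^ n"] by (simp add: abs_mult)
    have "(\<Sum>n. D n * x ^ n) = (\<Sum>n. (D n - c) * x ^ n) + c * (1 / (1 - x))"
      using suminf_add[OF smc[of c] summable_mult[OF sums_summable[OF sums], of c]]
        suminf_mult[OF sums_summable[OF sums], of c] sums_unique[OF sums]
      by (simp add: algebra_simps)
    then have "(1 - x) * (\<Sum>n. D n * x ^ n) - c = (1 - x) * (\<Sum>n. (D n - c) * x ^ n)"
      using x by (simp add: field_simps)
    moreover have "\<bar>\<Sum>n. (D n - c) * x ^ n\<bar> \<le> (\<Sum>n. \<bar>D n - c\<bar> * x ^ n)"
      using summable_rabs[of "\<lambda>n. (D n - c) * x ^ n"] sm[OF x, of c] x by (simp add: abs_mult)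
    moreover have "(\<Sum>n. \<bar>D n - c\<bar> * x ^ n) \<le> H + e / 2 * (1 / (1 - x))"
    proof -
      have "(\<Sum>n. \<bar>D n - c\<bar> * x ^ n) = (\<Sum>n. \<bar>D (n + N) - c\<bar> * x ^ (n + N)) + (\<Sum>n<N. \<bar>D n - c\<bar> * x ^ n)"
        by (rule suminf_split_initial_segment[OF sm[OF x]])
      also have "(\<Sum>n<N. \<bar>D n - c\<bar> * x ^ n) \<le> H"
        unfolding H_def using x by (intro sum_mono mult_left_le) (auto simp: power_le_one)
      also have "(\<Sum>n. \<bar>D (n + N) - c\<bar> * x ^ (n + N)) \<le> (\<Sum>n. e / 2 * x ^ n)"
      proof (rule suminf_le)
        show "summable (\<lambda>n. \<bar>D (n + N) - c\<bar> * x ^ (n + N))"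
          using sm[OF x] by (rule summable_ignore_initial_segment)
        show "summable (\<lambda>n. e / 2 * x ^ n)" by (intro summable_mult sums_summable[OF sums])
        fix n
        show "\<bar>D (n + N) - c\<bar> * x ^ (n + N) \<le> e / 2 * x ^ n"
          using N[of "n + N"] x e by (intro mult_mono power_decreasing) auto
      qed
      also have "(\<Sum>n. e / 2 * x ^ n) = e / 2 * (1 / (1 - x))"
        using suminf_mult[OF sums_summable[OF sums], of "e / 2"] sums_unique[OF sums] by simp
      finally show ?thesis by simp
    qed
    ultimately have "\<bar>(1 - x) * (\<Sum>n. D n * x ^ n) - c\<bar> \<le> (1 - x) * (H + e / 2 * (1 / (1 - x)))"
      using x by (auto simp: abs_mult intro!: mult_left_mono)
    also have "\<dots> = (1 - x) * H + e / 2" using x by (simp add: field_simps)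
    finally show ?thesis .
  qed
  have "((\<lambda>x. (1 - x) * H + e / 2) \<longlongrightarrow> (1 - 1) * H + e / 2) (at_left 1)"
    by (intro tendsto_intros)
  then have "\<forall>\<^sub>F x in at_left 1. (1 - x) * H + e / 2 < e"
    using e by (intro order_tendstoD(2)[of _ "(1 - 1) * H + e / 2"]) auto
  moreover have "\<forall>\<^sub>F x in at_left (1::real). x \<in> {0<..<1}"
    by (rule eventually_at_leftI) auto
  ultimately show "\<forall>\<^sub>F x in at_left 1. dist ((1 - x) * (\<Sum>n. D n * x ^ n)) c < e"
  proof eventually_elim
    case (elim x)
    then show ?case using bd[of x] by (auto simp: dist_real_def)
  qed
qed

subsection \<open>Mertens' third theorem\<close>

definition Mertens_prod :: "real \<Rightarrow> real" where
  "Mertens_prod y = (\<Prod>p\<in>primes_upto y. 1 - 1 / real p)"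

lemma prime_sum_block_bounds:
  fixes s :: real
  assumes s: "s > 0"
  defines "W \<equiv> (\<lambda>n. \<Sum>p\<in>primes_upto (exp (real n)). 1 / real p)"
  defines "Q \<equiv> (\<lambda>N. \<Sum>k<N. (W (Suc k) - W k) * exp (-s) ^ Suc k)"
  shows "Q N \<le> (\<Sum>p\<in>primes_upto (exp (real N)). real p powr (-(1 + s)))"
    and "(\<Sum>p\<in>primes_upto (exp (real N)). real p powr (-(1 + s))) \<le> exp s * Q N"
proof -
  define P where "P n = (\<Sum>p\<in>primes_upto (exp (real n)). real p powr (-(1 + s)))" for n
  have step: "(W (Suc n) - W n) * exp (-s) ^ Suc n \<le> P (Suc n) - P n"
             "P (Suc n) - P n \<le> exp s * ((W (Suc n) - W n) * exp (-s) ^ Suc n)" for n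
  proof -
    define S where "S = {p. prime p \<and> exp (real n) < real p \<and> real p \<le> exp (real (Suc n))}"
    have un: "primes_upto (exp (real (Suc n))) = primes_upto (exp (real n)) \<union> S"
      by (auto simp: S_def primes_upto_def intro: order_trans)
    have fin: "finite S" using finite_primes_upto[of "exp (real (Suc n))"] unfolding un by simp
    have dj: "primes_upto (exp (real n)) \<inter> S = {}" by (auto simp: S_def primes_upto_def)
    have W: "W (Suc n) - W n = (\<Sum>p\<in>S. 1 / real p)"
      unfolding W_def un using fin dj by (simp add: sum.union_disjoint)
    have P: "P (Suc n) - P n = (\<Sum>p\<in>S. real p powr (-(1 + s)))"
      unfolding P_def un using fin dj by (simp add: sum.union_disjoint)
    have pw: "exp (-s) ^ Suc n = exp (- s * real (Suc n))"
      by (metis exp_of_nat_mult mult.commute)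
    have bds: "1 / real p * exp (- s * real (Suc n)) \<le> real p powr (-(1 + s))"
         "real p powr (-(1 + s)) \<le> exp s * (1 / real p * exp (- s * real (Suc n)))" if "p \<in> S" for p
    proof -
      have p: "real p > 0" using that prime_gt_0_nat by (auto simp: S_def)
      have eq: "real p powr (-(1 + s)) = 1 / real p * exp (-s * ln (real p))"
        using p by (simp add: powr_def distrib_right exp_diff exp_minus field_simps)
      have "real n \<le> ln (real p)" "ln (real p) \<le> real (Suc n)"
        using that p by (auto simp: S_def ln_ge_iff ln_le_cancel_iff[symmetric, of _ "exp _"] simp del: ln_le_cancel_iff)
      then have "- s * real (Suc n) \<le> -s * ln (real p)" "-s * ln (real p) \<le> s + (- s * real (Suc n))"
        using s mult_left_mono[of "ln (real p)" "1 + real n" s] mult_left_mono[of "real n" "ln (real p)" s]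
        by (auto simp: algebra_simps)
      then have "exp (- s * real (Suc n)) \<le> exp (-s * ln (real p))"
        "exp (-s * ln (real p)) \<le> exp s * exp (- s * real (Suc n))"
        unfolding exp_add[symmetric] by (auto simp only: exp_le_cancel_iff)
      then show "1 / real p * exp (- s * real (Suc n)) \<le> real p powr (-(1 + s))"
        "real p powr (-(1 + s)) \<le> exp s * (1 / real p * exp (- s * real (Suc n)))"
        unfolding eq using p by (auto simp: field_simps)
    qed
    show "(W (Suc n) - W n) * exp (-s) ^ Suc n \<le> P (Suc n) - P n"
      unfolding W P pw sum_distrib_right by (intro sum_mono bds)
    show "P (Suc n) - P n \<le> exp s * ((W (Suc n) - W n) * exp (-s) ^ Suc n)"
      unfolding W P pw sum_distrib_right sum_distrib_left by (intro sum_mono bds)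
  qed
  have P0: "P 0 = 0" by (simp add: P_def primes_upto_eq_empty)
  have "P N = (\<Sum>k<N. P (Suc k) - P k)" using P0 by (simp add: sum_lessThan_telescope)
  then show "Q N \<le> (\<Sum>p\<in>primes_upto (exp (real N)). real p powr (-(1 + s)))"
     "(\<Sum>p\<in>primes_upto (exp (real N)). real p powr (-(1 + s))) \<le> exp s * Q N"
    unfolding P_def[symmetric] Q_def sum_distrib_left using step by (auto intro!: sum_mono)
qed

text \<open>Brings the power series of the increments of \<open>D\<close> into the shape treated by
  \<open>Abelian_mean\<close>; \<open>D 0 = 0\<close> removes the lower boundary term.\<close>

lemma Abel_summation_limit:
  fixes D :: "nat \<Rightarrow> real"
  assumes "D \<longlonglongrightarrow> c" "D 0 = 0" "0 < x" "x < 1"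
  shows "(\<lambda>N. \<Sum>k<N. (D (Suc k) - D k) * x ^ Suc k) \<longlonglongrightarrow> (1 - x) * (\<Sum>n. D n * x ^ n)"
proof -
  have eq: "(\<Sum>k<N. (D (Suc k) - D k) * x ^ Suc k) = D N * x ^ N + (1 - x) * (\<Sum>k<N. D k * x ^ k)" for N
    using assms(2) by (induction N) (auto simp: algebra_simps)
  obtain K where K: "\<And>n. \<bar>D n\<bar> \<le> K"
    using convergent_imp_Bseq[of D] assms by (auto simp: convergentI Bseq_def)
  have "summable (\<lambda>n. D n * x ^ n)"
  proof (rule summable_comparison_test)
    show "summable (\<lambda>n. K * x ^ n)" using assms by (intro summable_mult summable_geometric) auto
    show "\<exists>N. \<forall>n\<ge>N. norm (D n * x ^ n) \<le> K * x ^ n"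
      using K assms by (auto simp: abs_mult intro!: mult_right_mono)
  qed
  then have "(\<lambda>N. \<Sum>k<N. D k * x ^ k) \<longlonglongrightarrow> (\<Sum>n. D n * x ^ n)" by (rule summable_LIMSEQ)
  moreover have "(\<lambda>N. x ^ N) \<longlonglongrightarrow> 0" using assms by (intro LIMSEQ_power_zero) auto
  ultimately have "(\<lambda>N. D N * x ^ N + (1 - x) * (\<Sum>k<N. D k * x ^ k)) \<longlonglongrightarrow>
      c * 0 + (1 - x) * (\<Sum>n. D n * x ^ n)"
    by (intro tendsto_add tendsto_mult tendsto_const assms)
  then show ?thesis unfolding eq by simp
qed

lemma sum_over_primes_upto_eq:
  "(\<Sum>p\<in>primes_upto (real N). f p) = (\<Sum>k<Suc N. if prime k then f k else (0::real))"
proof -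
  have "primes_upto (real N) = {k\<in>{..<Suc N}. prime k}" by (auto simp: primes_upto_of_nat)
  then show ?thesis by (simp only: sum.inter_filter[OF finite_lessThan])
qed

lemma filterlim_nat_floor_at_top: "filterlim (\<lambda>x::real. nat \<lfloor>x\<rfloor>) at_top at_top"
  by (intro filterlim_compose[OF filterlim_nat_sequentially] filterlim_floor_sequentially)

lemma minus_ln_remainder_bounds:
  fixes t :: real
  assumes "0 \<le> t" "t \<le> 1 / 2"
  shows "0 \<le> - ln (1 - t) - t" "- ln (1 - t) - t \<le> 2 * t\<^sup>2"
  using ln_one_minus_pos_upper_bound[of t] ln_one_minus_pos_lower_bound[of t] assms by auto

text \<open>The constant is found by comparing the sum of \<open>p powr -(1 + s)\<close> with the sum of
  \<open>exp (-s * n) / n\<close>, that is \<open>- ln (1 - exp (-s))\<close>, as \<open>s\<close> tends to 0: the reciprocals of the primes up to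
  \<open>exp n\<close> and \<open>harm n\<close> differ by a convergent sequence, whose limit is preserved by Abel summation,
  whereas the Euler product ties the first sum to \<open>real_zeta (1 + s)\<close>, which is asymptotically \<open>1 / s\<close>.\<close>

lemma Mertens_third_nat:
  "(\<lambda>N. Mertens_prod (real N) * ln (real N)) \<longlonglongrightarrow> exp (- euler_mascheroni)"
proof -
  obtain B where B: "(\<lambda>n. (\<Sum>p\<in>primes_upto (real n). 1 / real p) - ln (ln (real n))) \<longlonglongrightarrow> B"
    using Mertens_second by blast
  \<comment> \<open>This is the limit of \<open>D\<close>, since \<open>W n - ln n\<close> tends to
    \<open>B\<close> and \<open>harm n - ln n\<close> to \<gamma>. The goal is to show that it
    equals \<open>- G 0\<close>.\<close>
  define c where "c = B - euler_mascheroni"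
  define W where "W n = (\<Sum>p\<in>primes_upto (exp (real n)). 1 / real p)" for n :: nat
  define D where "D n = W n - harm n" for n :: nat
  \<comment> \<open>The part of \<open>- ln (1 - p powr (-(1 + s)))\<close> that comes from the
    second and higher powers of \<open>p\<close>; it is summable even at
    \<open>s = 0\<close>.\<close>
  define g where "g s p = - ln (1 - real p powr (-(1 + s))) - real p powr (-(1 + s))" for s :: real and p :: nat
  define a where "a p s = (if prime p then g s p else 0)" for p s
  define G where "G s = (\<Sum>p. a p s)" for s
  define L where "L x = (1 - x) * (\<Sum>n. D n * x ^ n)" for x
  define Q where "Q s = L (exp (-s)) - ln (1 - exp (-s))" for s

  have floor_exp: "filterlim (\<lambda>n::nat. nat \<lfloor>exp (real n)\<rfloor>) at_top at_top"
    by (rule filterlim_compose[OF filterlim_nat_floor_at_top]) real_asymp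
  have primes_exp: "primes_upto (exp (real n)) = primes_upto (real (nat \<lfloor>exp (real n)\<rfloor>))" for n :: nat
    by (rule primes_upto_floor) auto
  have D: "D \<longlonglongrightarrow> c"
  proof -
    have 1: "(\<lambda>n. W n - ln (ln (real (nat \<lfloor>exp (real n)\<rfloor>)))) \<longlonglongrightarrow> B"
      unfolding W_def primes_exp by (rule filterlim_compose[OF B floor_exp])
    have 2: "(\<lambda>n. ln (ln (real (nat \<lfloor>exp (real n)\<rfloor>))) - ln (real n)) \<longlonglongrightarrow> 0"
    proof (rule tendsto_sandwich)
      \<comment> \<open>From 4 on, \<open>exp n - 1\<close> exceeds 3 and hence \<open>e\<close>, so
        the inner logarithms exceed 1 and the outer ones are monotone.\<close>
      have ev: "\<forall>\<^sub>F n::nat in sequentially. n \<ge> 4" by (rule eventually_ge_at_top)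
      have m: "exp (real n) - 1 \<le> real (nat \<lfloor>exp (real n)\<rfloor>)" "real (nat \<lfloor>exp (real n)\<rfloor>) \<le> exp (real n)" for n :: nat
        using exp_gt_zero[of "real n"] by linarith+
      have big: "exp (real n) - 1 > 3" if "n \<ge> 4" for n
        using exp_ge_add_one_self[of "real n"] that by linarith
      have l1: "ln (exp (real n) - 1) > 1" if "n \<ge> 4" for n
      proof -
        have "exp 1 < exp (real n) - 1" using big[OF that] exp_le by linarith
        then have "ln (exp 1) < ln (exp (real n) - 1)" using big[OF that] by (intro iffD2[OF ln_less_cancel_iff]) (linarith | simp)+
        then show ?thesis by simp
      qed
      show "\<forall>\<^sub>F n in sequentially. ln (ln (exp (real n) - 1)) - ln (real n) \<le>
          ln (ln (real (nat \<lfloor>exp (real n)\<rfloor>))) - ln (real n)"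
        using ev
      proof eventually_elim
        case (elim n)
        have "ln (exp (real n) - 1) \<le> ln (real (nat \<lfloor>exp (real n)\<rfloor>))"
          using m[of n] big[OF elim] by (intro ln_mono) linarith+
        then show ?case using l1[OF elim] ln_mono[of "ln (exp (real n) - 1)" "ln (real (nat \<lfloor>exp (real n)\<rfloor>))"] by linarith
      qed
      show "\<forall>\<^sub>F n in sequentially. ln (ln (real (nat \<lfloor>exp (real n)\<rfloor>))) - ln (real n) \<le> 0"
        using ev
      proof eventually_elim
        case (elim n)
        have "ln (exp (real n) - 1) \<le> ln (real (nat \<lfloor>exp (real n)\<rfloor>))"
          using m[of n] big[OF elim] by (intro ln_mono) linarith+
        moreover have "ln (real (nat \<lfloor>exp (real n)\<rfloor>)) \<le> ln (exp (real n))"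
          using m[of n] big[OF elim] by (intro ln_mono) linarith+
        ultimately show ?case using l1[OF elim] ln_mono[of "ln (real (nat \<lfloor>exp (real n)\<rfloor>))" "ln (exp (real n))"]
          unfolding ln_exp by linarith
      qed
      show "(\<lambda>n. ln (ln (exp (real n) - 1)) - ln (real n)) \<longlonglongrightarrow> 0" by real_asymp
    qed auto
    have "(\<lambda>n. (W n - ln (ln (real (nat \<lfloor>exp (real n)\<rfloor>)))) +
        (ln (ln (real (nat \<lfloor>exp (real n)\<rfloor>))) - ln (real n)) - (harm n - ln (real n))) \<longlonglongrightarrow> B + 0 - euler_mascheroni"
      by (intro tendsto_intros 1 2 euler_mascheroni_LIMSEQ)
    then show ?thesis by (simp add: c_def D_def[abs_def] algebra_simps)
  qed
  have D0: "D 0 = 0" by (simp add: D_def W_def primes_upto_eq_empty harm_def)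

  \<comment> \<open>A bound uniform in \<open>s\<close>, as Tannery's theorem requires for letting
    \<open>s\<close> tend to 0 inside the sum.\<close>
  have g_bound: "norm (a p s) \<le> 2 * real p powr (-2)" if "s \<ge> 0" for p s
  proof (cases "prime p")
    case True
    then have p: "real p \<ge> 2" using prime_ge_2_nat[of p] by simp
    define t where "t = real p powr (-(1 + s))"
    have "t \<le> real p powr (-1)" unfolding t_def using p that by (intro powr_mono) auto
    then have t: "0 \<le> t" "t \<le> 1 / real p" using p by (auto simp: t_def powr_minus_divide)
    moreover have "1 / real p \<le> 1 / 2" using p by simp
    ultimately have "norm (a p s) \<le> 2 * t\<^sup>2"
      using minus_ln_remainder_bounds[of t] t True by (simp add: a_def g_def t_def)
    also have "t\<^sup>2 \<le> (1 / real p)\<^sup>2" using t by (intro power_mono) auto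
    also have "(1 / real p)\<^sup>2 = real p powr (-2)" using p by (simp add: powr_minus_divide power_divide powr_numeral)
    finally show ?thesis by simp
  qed (auto simp: a_def)
  have sumM: "summable (\<lambda>p. 2 * real p powr (-2))" by (intro summable_mult) (simp add: summable_real_powr_iff)
  have G_sums: "(\<lambda>N. \<Sum>p\<in>primes_upto (real N). g s p) \<longlonglongrightarrow> G s" if "s \<ge> 0" for s
  proof -
    have "summable (\<lambda>p. a p s)"
      by (rule summable_comparison_test[OF _ sumM]) (use g_bound[OF that] in auto)
    then have "(\<lambda>N. \<Sum>p<Suc N. a p s) \<longlonglongrightarrow> G s"
      unfolding G_def by (intro LIMSEQ_Suc summable_LIMSEQ)
    then show ?thesis unfolding sum_over_primes_upto_eq a_def .
  qed
  have G_lim: "(G \<longlongrightarrow> G 0) (at_right 0)"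
  proof -
    have "((\<lambda>s. suminf (\<lambda>p. a p s)) \<longlongrightarrow> suminf (\<lambda>p. a p 0)) (at_right 0)"
    proof (rule tannerys_theorem[THEN conjunct2, THEN conjunct2])
      fix p
      show "((\<lambda>s. a p s) \<longlongrightarrow> a p 0) (at_right 0)"
      proof (cases "prime p")
        case True
        then have p: "real p \<ge> 2" using prime_ge_2_nat[of p] by simp
        then have pos: "1 - real p powr (-(1 + 0)) \<noteq> 0" by (simp add: powr_minus_divide)
        have lim: "((\<lambda>s. real p powr (-(1 + s))) \<longlongrightarrow> real p powr (-(1 + 0))) (at_right 0)"
          using p by (intro tendsto_intros) auto
        have "((\<lambda>s. g s p) \<longlongrightarrow> g 0 p) (at_right 0)"
          unfolding g_def by (intro tendsto_diff tendsto_minus tendsto_ln tendsto_const lim pos)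
        then show ?thesis unfolding a_def using True by simp
      qed (auto simp: a_def)
    next
      show "\<forall>\<^sub>F (k, s) in at_top \<times>\<^sub>F at_right 0. norm (a k s) \<le> 2 * real k powr (-2)"
        unfolding eventually_prod_filter
        by (intro exI[of _ "\<lambda>_. True"] exI[of _ "\<lambda>s. s > 0"])
           (use g_bound in \<open>auto simp: eventually_at_right_less\<close>)
    qed (use sumM in auto)
    then show ?thesis unfolding G_def .
  qed

  \<comment> \<open>By the logarithm of the Euler product,
    \<open>ln (real_zeta (1 + s)) - G s\<close> is the sum of \<open>p powr (-(1 + s))\<close> over
    all primes. \<open>Q s\<close> is the limit of the block sums: their \<open>D\<close> part
    yields \<open>L\<close>, their harmonic part the logarithmic series.\<close>
  have sandwich: "Q s \<le> ln (real_zeta (1 + s)) - G s" "ln (real_zeta (1 + s)) - G s \<le> exp s * Q s"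
    if s: "s > 0" for s
  proof -
    have zpos: "real_zeta (1 + s) > 0"
      using real_zeta_bounds(1)[OF s] s by (smt (verit) mult_nonneg_nonpos)
    have lim_P: "(\<lambda>N. \<Sum>p\<in>primes_upto (real N). real p powr (-(1 + s))) \<longlonglongrightarrow> ln (real_zeta (1 + s)) - G s"
    proof -
      have fac: "1 - real p powr (-(1 + s)) > 0" if "p \<in> primes_upto x" for p x
      proof -
        have "real p powr (-(1 + s)) < real p powr 0"
          using s primes_uptoD[OF that] by (intro powr_less_mono) auto
        then show ?thesis using primes_uptoD[OF that] by simp
      qed
      have "(\<lambda>N. ln (real_zeta (1 + s) * (\<Prod>p\<in>primes_upto (real N). 1 - real p powr (-(1 + s))))) \<longlonglongrightarrow> ln 1"
        using s by (intro tendsto_ln real_zeta_Euler_product) auto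
      moreover have "ln (real_zeta (1 + s) * (\<Prod>p\<in>primes_upto (real N). 1 - real p powr (-(1 + s)))) =
          ln (real_zeta (1 + s)) + (\<Sum>p\<in>primes_upto (real N). ln (1 - real p powr (-(1 + s))))" for N
      proof -
        have "(\<Prod>p\<in>primes_upto (real N). 1 - real p powr (-(1 + s))) > 0" by (intro prod_pos fac)
        moreover have "ln (real_zeta (1 + s) * t) = ln (real_zeta (1 + s)) + ln t" if "t > 0" for t
          using zpos that by (simp add: ln_mult)
        moreover have "ln (\<Prod>p\<in>primes_upto (real N). 1 - real p powr (-(1 + s))) =
            (\<Sum>p\<in>primes_upto (real N). ln (1 - real p powr (-(1 + s))))"
          by (intro ln_prod finite_primes_upto) (metis fac less_irrefl)
        ultimately show ?thesis by (simp only:)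
      qed
      ultimately have 1: "(\<lambda>N. ln (real_zeta (1 + s)) + (\<Sum>p\<in>primes_upto (real N). ln (1 - real p powr (-(1 + s))))) \<longlonglongrightarrow> 0"
        by simp
      have "(\<lambda>N. ln (real_zeta (1 + s)) - (ln (real_zeta (1 + s)) + (\<Sum>p\<in>primes_upto (real N). ln (1 - real p powr (-(1 + s)))))
           - (\<Sum>p\<in>primes_upto (real N). g s p)) \<longlonglongrightarrow> ln (real_zeta (1 + s)) - 0 - G s"
        using s by (intro tendsto_intros 1 G_sums) auto
      then show ?thesis by (simp add: g_def sum_subtractf sum_negf)
    qed
    then have lim_P': "(\<lambda>n. \<Sum>p\<in>primes_upto (exp (real n)). real p powr (-(1 + s))) \<longlonglongrightarrow> ln (real_zeta (1 + s)) - G s"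
      unfolding primes_exp by (rule filterlim_compose[OF _ floor_exp])
    have x: "0 < exp (-s)" "exp (-s) < 1" using s by auto
    have "(\<lambda>n. - ((- (-exp (-s))) ^ n) / real n) sums ln (1 + - exp (-s))"
      using x by (intro ln_series') auto
    then have "(\<lambda>n. exp (-s) ^ n / real n) sums (- ln (1 - exp (-s)))"
      using sums_minus by fastforce
    then have "(\<lambda>k. exp (-s) ^ Suc k / real (Suc k)) sums (- ln (1 - exp (-s)))"
      by (subst sums_Suc_iff) auto
    then have "(\<lambda>N. (\<Sum>k<N. (D (Suc k) - D k) * exp (-s) ^ Suc k) + (\<Sum>k<N. exp (-s) ^ Suc k / real (Suc k)))
        \<longlonglongrightarrow> L (exp (-s)) + - ln (1 - exp (-s))"
      unfolding L_def sums_def by (intro tendsto_add Abel_summation_limit[OF D D0 x])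
    then have lim_Q: "(\<lambda>N. \<Sum>k<N. (W (Suc k) - W k) * exp (-s) ^ Suc k) \<longlonglongrightarrow> Q s"
      unfolding sum.distrib[symmetric] Q_def D_def harm_Suc
      by (simp add: algebra_simps divide_inverse del: of_nat_Suc power_Suc)
    show "Q s \<le> ln (real_zeta (1 + s)) - G s"
      using prime_sum_block_bounds(1)[OF s] by (intro LIMSEQ_le[OF lim_Q lim_P']) (auto simp: W_def)
    show "ln (real_zeta (1 + s)) - G s \<le> exp s * Q s"
      using prime_sum_block_bounds(2)[OF s]
      by (intro LIMSEQ_le[OF lim_P' tendsto_mult[OF tendsto_const lim_Q]]) (auto simp: W_def)
  qed

  have "c = - G 0"
  proof -
    have "filterlim (\<lambda>s::real. exp (-s)) (at_left 1) (at_right 0)" by real_asymp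
    then have L: "((\<lambda>s. L (exp (-s))) \<longlongrightarrow> c) (at_right 0)"
      unfolding L_def by (rule filterlim_compose[OF Abelian_mean[OF D]])
    have pos: "\<forall>\<^sub>F s::real in at_right 0. s > 0" by (rule eventually_at_right_less)
    \<comment> \<open>The sandwich leaves an error of at most \<open>(exp s - 1) * Q s\<close>.
      Although \<open>Q s\<close> grows like \<open>- ln s\<close>, the factor
      \<open>exp s - 1\<close> outweighs it.\<close>
    have F0: "((\<lambda>s. ln (real_zeta (1 + s)) - G s - Q s) \<longlongrightarrow> 0) (at_right 0)"
    proof (rule tendsto_sandwich)
      show "\<forall>\<^sub>F s in at_right 0. 0 \<le> ln (real_zeta (1 + s)) - G s - Q s"
        using pos by eventually_elim (use sandwich in fastforce)
      show "\<forall>\<^sub>F s in at_right 0. ln (real_zeta (1 + s)) - G s - Q s \<le>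
          (exp s - 1) * L (exp (-s)) - (exp s - 1) * ln (1 - exp (-s))"
        using pos
      proof eventually_elim
        case (elim s)
        then show ?case using sandwich(2)[of s] by (simp add: Q_def algebra_simps)
      qed
      have "((\<lambda>s::real. exp s - 1) \<longlongrightarrow> 0) (at_right 0)" by real_asymp
      moreover have "((\<lambda>s::real. (exp s - 1) * ln (1 - exp (-s))) \<longlongrightarrow> 0) (at_right 0)" by real_asymp
      ultimately have "((\<lambda>s. (exp s - 1) * L (exp (-s)) - (exp s - 1) * ln (1 - exp (-s))) \<longlongrightarrow> 0 * c - 0) (at_right 0)"
        by (intro tendsto_diff tendsto_mult L)
      then show "((\<lambda>s. (exp s - 1) * L (exp (-s)) - (exp s - 1) * ln (1 - exp (-s))) \<longlongrightarrow> 0) (at_right 0)"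
        by simp
    qed auto
    have "((\<lambda>s. s * real_zeta (1 + s)) \<longlongrightarrow> 1) (at_right 0)"
    proof (rule tendsto_sandwich)
      show "\<forall>\<^sub>F s in at_right 0. 1 \<le> s * real_zeta (1 + s)"
        using pos by eventually_elim (rule real_zeta_bounds)
      show "\<forall>\<^sub>F s in at_right 0. s * real_zeta (1 + s) \<le> s + 1"
        using pos by eventually_elim (rule real_zeta_bounds)
      show "((\<lambda>s::real. s + 1) \<longlongrightarrow> 1) (at_right 0)" by real_asymp
    qed auto
    then have Z: "((\<lambda>s. ln (s * real_zeta (1 + s))) \<longlongrightarrow> ln 1) (at_right 0)"
      by (intro tendsto_ln) auto
    \<comment> \<open>The singularities \<open>- ln s\<close> of
      \<open>ln (real_zeta (1 + s))\<close> and of \<open>Q s\<close> cancel; what remains tends to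
      \<open>- G 0 - c\<close>, which must therefore be 0.\<close>
    have "((\<lambda>s::real. ln (1 - exp (-s)) - ln s) \<longlongrightarrow> 0) (at_right 0)" by real_asymp
    then have "((\<lambda>s. ln (s * real_zeta (1 + s)) - G s - L (exp (-s)) + (ln (1 - exp (-s)) - ln s)) \<longlongrightarrow>
        ln 1 - G 0 - c + 0) (at_right 0)"
      by (intro tendsto_intros Z G_lim L)
    moreover have "\<forall>\<^sub>F s in at_right 0. ln (s * real_zeta (1 + s)) - G s - L (exp (-s)) + (ln (1 - exp (-s)) - ln s) =
        ln (real_zeta (1 + s)) - G s - Q s"
      using pos
    proof eventually_elim
      case (elim s)
      have "real_zeta (1 + s) > 0"
        using real_zeta_bounds(1)[OF elim] elim by (smt (verit) mult_nonneg_nonpos)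
      then show ?case using elim by (simp add: ln_mult Q_def)
    qed
    ultimately have "((\<lambda>s. ln (real_zeta (1 + s)) - G s - Q s) \<longlongrightarrow> ln 1 - G 0 - c + 0) (at_right 0)"
      by (rule Lim_transform_eventually)
    from tendsto_unique[OF _ this F0] show ?thesis by simp
  qed

  \<comment> \<open>The case \<open>s = 0\<close> of the splitting by \<open>g\<close>: adding
    \<open>ln (ln N)\<close> leaves the limit \<open>- B - G 0\<close>, which is -\<gamma> by the
    value of \<open>c\<close>.\<close>
  have lnV: "ln (Mertens_prod (real N)) = - (\<Sum>p\<in>primes_upto (real N). 1 / real p) - (\<Sum>p\<in>primes_upto (real N). g 0 p)" for N
  proof -
    have fac: "1 - 1 / real p > 0" if "p \<in> primes_upto x" for p x
      using primes_uptoD[OF that] by (auto simp: field_simps)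
    have "ln (Mertens_prod (real N)) = (\<Sum>p\<in>primes_upto (real N). ln (1 - 1 / real p))"
      unfolding Mertens_prod_def by (intro ln_prod finite_primes_upto) (metis fac less_irrefl)
    also have "\<dots> = (\<Sum>p\<in>primes_upto (real N). - (1 / real p) - g 0 p)"
      by (intro sum.cong refl) (auto simp: g_def powr_minus_divide dest!: primes_uptoD)
    finally show ?thesis by (simp add: sum_subtractf sum_negf)
  qed
  have "(\<lambda>N. - ((\<Sum>p\<in>primes_upto (real N). 1 / real p) - ln (ln (real N))) - (\<Sum>p\<in>primes_upto (real N). g 0 p))
      \<longlonglongrightarrow> - B - G 0"
    by (intro tendsto_intros B G_sums) auto
  also have "- B - G 0 = - euler_mascheroni" using \<open>c = - G 0\<close> by (simp add: c_def)
  finally have "(\<lambda>N. exp (ln (Mertens_prod (real N)) + ln (ln (real N)))) \<longlonglongrightarrow> exp (- euler_mascheroni)"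
    by (intro tendsto_exp) (simp add: lnV algebra_simps)
  moreover have "\<forall>\<^sub>F N in sequentially. exp (ln (Mertens_prod (real N)) + ln (ln (real N))) = Mertens_prod (real N) * ln (real N)"
    using eventually_ge_at_top[of 2]
  proof eventually_elim
    case (elim N)
    have "Mertens_prod (real N) > 0"
      unfolding Mertens_prod_def by (intro prod_pos) (auto simp: field_simps dest!: primes_uptoD)
    then show ?case using elim by (simp add: exp_add)
  qed
  ultimately show ?thesis by (rule Lim_transform_eventually)
qed

lemma Mertens_third: "((\<lambda>y. Mertens_prod y * ln y) \<longlongrightarrow> exp (- euler_mascheroni)) at_top"
proof -
  have 1: "((\<lambda>y::real. Mertens_prod (real (nat \<lfloor>y\<rfloor>)) * ln (real (nat \<lfloor>y\<rfloor>))) \<longlongrightarrow> exp (- euler_mascheroni)) at_top"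
    using filterlim_compose[OF Mertens_third_nat filterlim_nat_floor_at_top] .
  have 2: "((\<lambda>y::real. ln y / ln (real (nat \<lfloor>y\<rfloor>))) \<longlongrightarrow> 1) at_top"
  proof (rule tendsto_sandwich)
    show "\<forall>\<^sub>F y::real in at_top. 1 \<le> ln y / ln (real (nat \<lfloor>y\<rfloor>))"
      using eventually_ge_at_top[of 3]
    proof eventually_elim
      case (elim y)
      have "1 < real (nat \<lfloor>y\<rfloor>)" "real (nat \<lfloor>y\<rfloor>) \<le> y" using elim by linarith+
      then show ?case by (simp add: le_divide_eq_1)
    qed
    show "\<forall>\<^sub>F y::real in at_top. ln y / ln (real (nat \<lfloor>y\<rfloor>)) \<le> ln y / ln (y - 1)"
      using eventually_ge_at_top[of 3]
    proof eventually_elim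
      case (elim y)
      have "1 < real (nat \<lfloor>y\<rfloor>)" "y - 1 \<le> real (nat \<lfloor>y\<rfloor>)" using elim by linarith+
      then show ?case using elim by (intro divide_left_mono) auto
    qed
    show "((\<lambda>y::real. ln y / ln (y - 1)) \<longlongrightarrow> 1) at_top" by real_asymp
  qed auto
  have "((\<lambda>y. Mertens_prod (real (nat \<lfloor>y\<rfloor>)) * ln (real (nat \<lfloor>y\<rfloor>)) * (ln y / ln (real (nat \<lfloor>y\<rfloor>)))) \<longlongrightarrow>
      exp (- euler_mascheroni) * 1) at_top"
    by (intro tendsto_mult 1 2)
  moreover have "\<forall>\<^sub>F y in at_top. Mertens_prod (real (nat \<lfloor>y\<rfloor>)) * ln (real (nat \<lfloor>y\<rfloor>)) * (ln y / ln (real (nat \<lfloor>y\<rfloor>))) =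
      Mertens_prod y * ln y"
    using eventually_ge_at_top[of 3]
  proof eventually_elim
    case (elim y)
    have "1 < real (nat \<lfloor>y\<rfloor>)" using elim by linarith
    then have "ln (real (nat \<lfloor>y\<rfloor>)) > 0" by (rule ln_gt_zero)
    then have "ln (real (nat \<lfloor>y\<rfloor>)) \<noteq> 0" by linarith
    moreover have "Mertens_prod (real (nat \<lfloor>y\<rfloor>)) = Mertens_prod y"
      unfolding Mertens_prod_def using primes_upto_floor[of y] elim by simp
    ultimately show ?case by simp
  qed
  ultimately have "((\<lambda>y. Mertens_prod y * ln y) \<longlongrightarrow> exp (- euler_mascheroni) * 1) at_top"
    by (rule Lim_transform_eventually)
  then show ?thesis by simp
qed

subsection \<open>The normal order of the number of prime divisors\<close>

lemma omega_eq_sum: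
  assumes "n \<in> {1..N}"
  shows "real (omega n) = (\<Sum>p\<in>primes_upto (real N). if p dvd n then 1 else 0)"
proof -
  have "{p. prime p \<and> p dvd n} = {p\<in>primes_upto (real N). p dvd n}"
    using assms by (auto simp: primes_upto_of_nat dest: dvd_imp_le)
  then show ?thesis
    by (simp add: omega_def sum.inter_filter[symmetric])
qed

lemma sqrt_div_self: "x > 0 \<Longrightarrow> sqrt x / x = 1 / sqrt x"
  by (simp add: field_simps)

text \<open>Expand the square and count multiples of primes and of products of two primes. The terms
  in the square of \<open>A N\<close> cancel, leaving only order \<open>N * A N\<close>.\<close>

lemma Turan_variance:
  defines "A \<equiv> (\<lambda>N. \<Sum>p\<in>primes_upto (real N). 1 / real p)"
  shows "(\<Sum>n\<in>{1..N}. (real (omega n) - A N)\<^sup>2) \<le> 3 * A N * real N"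
proof -
  let ?P = "primes_upto (real N)"
  have A: "A N \<ge> 0" unfolding A_def by (intro sum_nonneg) auto
  have sum_dvd: "(\<Sum>n\<in>{1..N}. if d dvd n then 1 else 0) = real (N div d)" if "d > 0" for d
    using card_multiples_upto[OF that, of N] by (simp add: sum.inter_filter[symmetric])
  have first: "(\<Sum>n\<in>{1..N}. real (omega n)) \<ge> real N * A N - real N"
  proof -
    have "(\<Sum>n\<in>{1..N}. real (omega n)) = (\<Sum>n\<in>{1..N}. \<Sum>p\<in>?P. if p dvd n then 1 else 0)"
      by (intro sum.cong refl omega_eq_sum)
    also have "\<dots> = (\<Sum>p\<in>?P. \<Sum>n\<in>{1..N}. if p dvd n then 1 else 0)" by (rule sum.swap)
    also have "\<dots> = (\<Sum>p\<in>?P. real (N div p))"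
      by (intro sum.cong refl sum_dvd) (auto dest: primes_uptoD)
    also have "\<dots> \<ge> (\<Sum>p\<in>?P. real N / real p - 1)" by (intro sum_mono real_div_ge)
    also have "(\<Sum>p\<in>?P. real N / real p - 1) = real N * A N - real (card ?P)"
      by (simp add: A_def sum_subtractf sum_distrib_left)
    finally have "real N * A N - real (card ?P) \<le> (\<Sum>n\<in>{1..N}. real (omega n))" .
    \<comment> \<open>The trivial bound for the number of primes suffices: it costs
      \<open>2 * A N * N\<close> in the variance, which is of the admissible order.\<close>
    moreover have "card ?P \<le> card {1..N}"
      by (intro card_mono) (auto simp: primes_upto_of_nat Suc_le_eq prime_gt_0_nat)
    ultimately show ?thesis by simp
  qed
  have second: "(\<Sum>n\<in>{1..N}. (real (omega n))\<^sup>2) \<le> real N * (A N)\<^sup>2 + real N * A N"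
  proof -
    have "(\<Sum>n\<in>{1..N}. (real (omega n))\<^sup>2) =
        (\<Sum>n\<in>{1..N}. \<Sum>p\<in>?P. \<Sum>q\<in>?P. if p dvd n \<and> q dvd n then 1 else 0)"
      by (intro sum.cong refl, subst omega_eq_sum, assumption)
         (auto simp: power2_eq_square sum_product intro!: sum.cong)
    also have "\<dots> = (\<Sum>p\<in>?P. \<Sum>n\<in>{1..N}. \<Sum>q\<in>?P. if p dvd n \<and> q dvd n then 1 else 0)"
      by (rule sum.swap)
    also have "\<dots> = (\<Sum>p\<in>?P. \<Sum>q\<in>?P. \<Sum>n\<in>{1..N}. if p dvd n \<and> q dvd n then 1 else 0)"
      by (intro sum.cong refl sum.swap)
    \<comment> \<open>The product term is granted to the diagonal pairs as well, so that the double
      sum factors into a full square of \<open>A N\<close>.\<close>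
    also have "\<dots> \<le> (\<Sum>p\<in>?P. \<Sum>q\<in>?P. real N * (1 / real p * (1 / real q)) + (if q = p then real N / real p else 0))"
    proof (intro sum_mono)
      fix p q assume p: "p \<in> ?P" and q: "q \<in> ?P"
      show "(\<Sum>n\<in>{1..N}. if p dvd n \<and> q dvd n then 1 else 0) \<le>
          real N * (1 / real p * (1 / real q)) + (if q = p then real N / real p else 0)"
      proof (cases "q = p")
        case True
        then have "(\<Sum>n\<in>{1..N}. if p dvd n \<and> q dvd n then 1 else 0) = real (N div p)"
          using sum_dvd[of p] primes_uptoD[OF p] by simp
        also have "\<dots> \<le> real N / real p" by (rule real_div_le)
        also have "\<dots> \<le> real N * (1 / real p * (1 / real q)) + real N / real p" by simp
        finally show ?thesis using True by simp
      next
        case False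
        have "coprime p q" using False primes_uptoD[OF p] primes_uptoD[OF q] by (intro primes_coprime) auto
        then have "p dvd n \<and> q dvd n \<longleftrightarrow> p * q dvd n" for n
          by (auto intro: divides_mult dvd_mult_left dvd_mult_right)
        then have "(\<Sum>n\<in>{1..N}. if p dvd n \<and> q dvd n then 1 else 0) = real (N div (p * q))"
          using sum_dvd[of "p * q"] primes_uptoD[OF p] primes_uptoD[OF q] by simp
        also have "\<dots> \<le> real N / real (p * q)" by (rule real_div_le)
        finally show ?thesis using False by simp
      qed
    qed
    also have "\<dots> = (\<Sum>p\<in>?P. \<Sum>q\<in>?P. real N * (1 / real p * (1 / real q))) + (\<Sum>p\<in>?P. real N / real p)"
      by (simp add: sum.distrib)
    also have "(\<Sum>p\<in>?P. \<Sum>q\<in>?P. real N * (1 / real p * (1 / real q))) = real N * (A N)\<^sup>2"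
      unfolding A_def power2_eq_square sum_product by (simp only: sum_distrib_left)
    also have "(\<Sum>p\<in>?P. real N / real p) = real N * A N"
      by (simp add: A_def sum_distrib_left)
    finally show ?thesis .
  qed
  have "(\<Sum>n\<in>{1..N}. (real (omega n) - A N)\<^sup>2) =
      (\<Sum>n\<in>{1..N}. (real (omega n))\<^sup>2) - 2 * A N * (\<Sum>n\<in>{1..N}. real (omega n)) + real N * (A N)\<^sup>2"
    by (simp add: power2_diff sum.distrib sum_subtractf sum_distrib_left algebra_simps)
  also have "\<dots> \<le> (real N * (A N)\<^sup>2 + real N * A N) - 2 * A N * (real N * A N - real N) + real N * (A N)\<^sup>2"
    using first second A mult_left_mono[OF first, of "2 * A N"] by linarith
  also have "\<dots> = 3 * A N * real N" by (simp add: power2_eq_square algebra_simps)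
  finally show ?thesis .
qed

definition omega_abnormal :: "nat \<Rightarrow> nat set" where
  "omega_abnormal N = {n\<in>{1..N}. \<not> (0.9 * ln (ln (real n)) < real (omega n) \<and>
                                      real (omega n) < 1.1 * ln (ln (real n)))}"

text \<open>Chebyshev's inequality applied to \<open>Turan_variance\<close>. Discarding
  \<open>n \<le> sqrt N\<close> makes \<open>ln (ln n)\<close> differ from \<open>ln (ln N)\<close>
  by at most 1.\<close>

lemma Hardy_Ramanujan: "(\<lambda>N. real (card (omega_abnormal N)) / real N) \<longlonglongrightarrow> 0"
proof -
  define A where "A N = (\<Sum>p\<in>primes_upto (real N). 1 / real p)" for N :: nat
  define l where "l N = ln (ln (real N))" for N :: nat
  obtain B where "(\<lambda>n. A n - l n) \<longlonglongrightarrow> B" unfolding A_def l_def using Mertens_second by blast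
  then obtain K0 where K0: "\<And>N. \<bar>A N - l N\<bar> \<le> K0"
    using convergent_imp_Bseq[of "\<lambda>n. A n - l n"] by (auto simp: convergentI Bseq_def)
  \<comment> \<open>An abnormal \<open>n\<close> deviates from \<open>A N\<close> by at least
    \<open>0.1 * l N - K0 - 1.1\<close>: \<open>K0\<close> accounts for replacing \<open>A N\<close>
    by \<open>l N\<close>, and 1.1 for the shift by 1 in \<open>1.1 * (l N - 1)\<close>. Half of the
    margin, \<open>0.05 * l N\<close>, is kept.\<close>
  have main: "real (card (omega_abnormal N)) \<le> sqrt (real N) + 3 * (l N + K0) * real N / (0.05 * l N)\<^sup>2"
    if N: "N \<ge> 3" and lN: "0.05 * l N \<ge> K0 + 1.1" "l N > 0" for N
  proof -
    define E where "E = {n\<in>{1..N}. (0.05 * l N)\<^sup>2 \<le> (real (omega n) - A N)\<^sup>2}"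
    have "omega_abnormal N \<subseteq> {1..nat \<lfloor>sqrt (real N)\<rfloor>} \<union> E"
    proof
      fix n assume n: "n \<in> omega_abnormal N"
      show "n \<in> {1..nat \<lfloor>sqrt (real N)\<rfloor>} \<union> E"
      proof (cases "real n \<le> sqrt (real N)")
        case True
        then show ?thesis using n by (auto simp: omega_abnormal_def le_nat_floor)
      next
        case False
        have n1: "1 \<le> n" "n \<le> N" using n by (auto simp: omega_abnormal_def)
        have "ln (sqrt (real N)) \<le> ln (real n)" using False N by (intro ln_mono) auto
        then have half: "ln (real N) / 2 \<le> ln (real n)" using N by (simp add: ln_sqrt)
        have lnN: "ln (real N) > 0" using N by simp
        have "ln (ln (real N) / 2) \<le> ln (ln (real n))" using half lnN by (intro ln_mono) auto
        moreover have "ln (ln (real N) / 2) = l N - ln 2" using lnN by (simp add: l_def ln_div)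
        moreover have "ln (2::real) \<le> 1" using ln_2_less_1 by simp
        ultimately have lower: "l N - 1 \<le> ln (ln (real n))" by linarith
        have "ln (real n) \<le> ln (real N)" using n1 by (intro ln_mono) auto
        then have upper: "ln (ln (real n)) \<le> l N" unfolding l_def using half lnN by (subst ln_le_cancel_iff) auto
        have "real (omega n) \<le> 0.9 * ln (ln (real n)) \<or> real (omega n) \<ge> 1.1 * ln (ln (real n))"
          using n by (auto simp: omega_abnormal_def)
        then have "0.05 * l N \<le> \<bar>real (omega n) - A N\<bar>"
        proof
          assume "real (omega n) \<le> 0.9 * ln (ln (real n))"
          then show ?thesis using upper K0[of N] lN by (auto simp: abs_if split: if_splits)
        next
          assume "real (omega n) \<ge> 1.1 * ln (ln (real n))"
          then show ?thesis using lower K0[of N] lN by (auto simp: abs_if split: if_splits)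
        qed
        then have "(0.05 * l N)\<^sup>2 \<le> (real (omega n) - A N)\<^sup>2"
          using lN by (intro abs_le_square_iff[THEN iffD1]) auto
        then show ?thesis using n1 by (auto simp: E_def)
      qed
    qed
    then have "card (omega_abnormal N) \<le> card ({1..nat \<lfloor>sqrt (real N)\<rfloor>} \<union> E)"
      by (intro card_mono) (auto simp: E_def)
    also have "\<dots> \<le> nat \<lfloor>sqrt (real N)\<rfloor> + card E"
      using card_Un_le[of "{1..nat \<lfloor>sqrt (real N)\<rfloor>}" E] by simp
    finally have 1: "real (card (omega_abnormal N)) \<le> real (nat \<lfloor>sqrt (real N)\<rfloor>) + real (card E)"
      by (metis of_nat_add of_nat_mono)
    have 2: "real (nat \<lfloor>sqrt (real N)\<rfloor>) \<le> sqrt (real N)" by simp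
    have "real (card E) * (0.05 * l N)\<^sup>2 = (\<Sum>n\<in>E. (0.05 * l N)\<^sup>2)" by simp
    also have "\<dots> \<le> (\<Sum>n\<in>E. (real (omega n) - A N)\<^sup>2)" by (intro sum_mono) (auto simp: E_def)
    also have "\<dots> \<le> (\<Sum>n\<in>{1..N}. (real (omega n) - A N)\<^sup>2)" by (intro sum_mono2) (auto simp: E_def)
    also have "\<dots> \<le> 3 * A N * real N" unfolding A_def by (rule Turan_variance)
    also have "\<dots> \<le> 3 * (l N + K0) * real N"
      using K0[of N] by (intro mult_right_mono mult_left_mono) auto
    finally have "real (card E) \<le> 3 * (l N + K0) * real N / (0.05 * l N)\<^sup>2"
      using lN by (simp add: pos_le_divide_eq)
    then show ?thesis using 1 2 by linarith
  qed
  have "filterlim l at_top sequentially" unfolding l_def by real_asymp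
  then have "\<forall>\<^sub>F N in sequentially. l N \<ge> max 1 ((K0 + 1.1) / 0.05)" unfolding filterlim_at_top by blast
  then have ev: "\<forall>\<^sub>F N in sequentially. real (card (omega_abnormal N)) / real N \<le>
      1 / sqrt (real N) + 3 * (l N + K0) / (0.05 * l N)\<^sup>2"
    using eventually_ge_at_top[of 3]
  proof eventually_elim
    case (elim N)
    have "real (card (omega_abnormal N)) / real N \<le>
       (sqrt (real N) + 3 * (l N + K0) * real N / (0.05 * l N)\<^sup>2) / real N"
      using elim by (intro divide_right_mono main) auto
    also have "\<dots> = sqrt (real N) / real N + 3 * (l N + K0) / (0.05 * l N)\<^sup>2"
      using elim by (simp add: add_divide_distrib)
    also have "sqrt (real N) / real N = 1 / sqrt (real N)"
      using elim by (intro sqrt_div_self) auto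
    finally show ?case .
  qed
  show ?thesis
  proof (rule tendsto_sandwich[OF _ ev tendsto_const])
    show "(\<lambda>N. 1 / sqrt (real N) + 3 * (l N + K0) / (0.05 * l N)\<^sup>2) \<longlonglongrightarrow> 0"
      unfolding l_def by real_asymp
  qed auto
qed

subsection \<open>The Legendre sieve\<close>

definition sifted :: "nat set \<Rightarrow> real \<Rightarrow> nat set" where
  "sifted S x = {m. m > 0 \<and> real m \<le> x \<and> (\<forall>p\<in>S. \<not> p dvd m)}"

lemma finite_sifted [simp, intro]: "finite (sifted S x)"
  by (rule finite_subset[of _ "{..nat \<lfloor>x\<rfloor>}"]) (auto simp: sifted_def le_nat_floor)

text \<open>Legendre's recursion: the numbers newly removed are \<open>p * m\<close> with
  \<open>m\<close> a survivor of \<open>S\<close>, as the primes of \<open>S\<close> do not see the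
  factor \<open>p\<close>.\<close>

lemma card_sifted_insert:
  assumes "prime p" "p \<notin> S" "\<And>q. q \<in> S \<Longrightarrow> prime q"
  shows "real (card (sifted (insert p S) x)) = real (card (sifted S x)) - real (card (sifted S (x / real p)))"
proof -
  have p: "p > 0" using assms by (simp add: prime_gt_0_nat)
  have dvd: "q dvd p * m \<longleftrightarrow> q dvd m" if "q \<in> S" for q m
  proof -
    have "coprime q p" using assms that by (intro primes_coprime) auto
    then show ?thesis by (simp add: coprime_dvd_mult_right_iff)
  qed
  have "sifted S x = sifted (insert p S) x \<union> (\<lambda>m. p * m) ` sifted S (x / real p)"
  proof (intro equalityI subsetI)
    fix n assume n: "n \<in> sifted S x"
    show "n \<in> sifted (insert p S) x \<union> (\<lambda>m. p * m) ` sifted S (x / real p)"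
    proof (cases "p dvd n")
      case True
      then obtain m where m: "n = p * m" by (elim dvdE)
      with n dvd p have "m \<in> sifted S (x / real p)" by (auto simp: sifted_def field_simps)
      with m show ?thesis by blast
    qed (use n in \<open>auto simp: sifted_def\<close>)
  qed (use dvd p in \<open>auto simp: sifted_def field_simps\<close>)
  moreover have "sifted (insert p S) x \<inter> (\<lambda>m. p * m) ` sifted S (x / real p) = {}"
    by (auto simp: sifted_def)
  ultimately have "card (sifted S x) = card (sifted (insert p S) x) + card ((\<lambda>m. p * m) ` sifted S (x / real p))"
    by (simp add: card_Un_disjoint)
  also have "card ((\<lambda>m. p * m) ` sifted S (x / real p)) = card (sifted S (x / real p))"
    using p by (intro card_image) (auto simp: inj_on_def)
  finally show ?thesis by simp
qed

text \<open>The bound \<open>min 1 x \<le> x powr \<sigma>\<close> for the error of each term of the Legendre sieve is Rankin's trick;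
  it is what keeps the total error small although there are exponentially many terms.\<close>

lemma Legendre_Rankin_sieve:
  assumes "finite S" "\<And>p. p \<in> S \<Longrightarrow> prime p" "0 \<le> \<sigma>" "\<sigma> \<le> 1" "x \<ge> 0"
  shows "\<bar>real (card (sifted S x)) - x * (\<Prod>p\<in>S. 1 - 1 / real p)\<bar> \<le>
           x powr \<sigma> * (\<Prod>p\<in>S. 1 + real p powr (-\<sigma>))"
  using assms(1,2,5)
proof (induction S arbitrary: x rule: finite_induct)
  case empty
  have "sifted {} x = {1..nat \<lfloor>x\<rfloor>}"
    using empty by (auto simp: sifted_def le_nat_floor Suc_le_eq) linarith
  then have card: "real (card (sifted {} x)) = of_int \<lfloor>x\<rfloor>" using empty by simp
  show ?case
  proof (cases "x \<ge> 1")
    case True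
    then have "1 \<le> x powr \<sigma>" using assms by (intro ge_one_powr_ge_zero) auto
    then show ?thesis unfolding card by simp linarith
  next
    case False
    then have "\<lfloor>x\<rfloor> = 0" using empty by linarith
    moreover have "x \<le> x powr \<sigma>"
    proof (cases "x = 0")
      case False
      then show ?thesis using empty \<open>\<not> x \<ge> 1\<close> assms powr_mono'[of \<sigma> 1 x] by simp
    qed auto
    ultimately show ?thesis unfolding card using empty by simp
  qed
next
  case (insert p S)
  have p: "prime p" "p > 0" using insert by (auto simp: prime_gt_0_nat)
  let ?V = "\<Prod>p\<in>S. 1 - 1 / real p" and ?E = "\<Prod>p\<in>S. 1 + real p powr (-\<sigma>)"
  have "real (card (sifted (insert p S) x)) - x * (\<Prod>p\<in>insert p S. 1 - 1 / real p) =
      (real (card (sifted S x)) - x * ?V) - (real (card (sifted S (x / real p))) - x / real p * ?V)"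
    using insert p by (subst card_sifted_insert) (auto simp: algebra_simps)
  \<comment> \<open>The error at \<open>x / p\<close> is \<open>p powr (-\<sigma>)\<close> times the
    error bound at \<open>x\<close>; this produces the new factor of the product.\<close>
  also have "\<bar>\<dots>\<bar> \<le> x powr \<sigma> * ?E + (x / real p) powr \<sigma> * ?E"
    using insert.IH[of x] insert.IH[of "x / real p"] insert.prems by fastforce
  also have "\<dots> = x powr \<sigma> * (\<Prod>p\<in>insert p S. 1 + real p powr (-\<sigma>))"
    using insert p by (simp add: powr_divide powr_minus field_simps)
  finally show ?case .
qed

text \<open>Rankin's exponent is \<open>1 - \<epsilon>\<close>. The error product is bounded through
  \<open>1 + t \<le> exp t\<close>, and \<open>p powr \<epsilon> \<le> y powr \<epsilon>\<close>
  reduces the exponent to a sum of reciprocals, for which the harmonic sum over all integers is good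
  enough.\<close>

lemma card_sifted_primes_upto:
  assumes "y \<ge> 1" "0 \<le> \<epsilon>" "\<epsilon> \<le> 1" "x \<ge> 0"
  shows "\<bar>real (card (sifted (primes_upto y) x)) - x * Mertens_prod y\<bar> \<le>
           x powr (1 - \<epsilon>) * exp (y powr \<epsilon> * (1 + ln y))"
proof -
  have "\<bar>real (card (sifted (primes_upto y) x)) - x * Mertens_prod y\<bar> \<le>
      x powr (1 - \<epsilon>) * (\<Prod>p\<in>primes_upto y. 1 + real p powr (-(1 - \<epsilon>)))"
    unfolding Mertens_prod_def using assms
    by (intro Legendre_Rankin_sieve finite_primes_upto) (auto simp: primes_upto_def)
  also have "(\<Prod>p\<in>primes_upto y. 1 + real p powr (-(1 - \<epsilon>))) \<le> (\<Prod>p\<in>primes_upto y. exp (real p powr (-(1 - \<epsilon>))))"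
    by (intro prod_mono) (auto intro!: exp_ge_add_one_self simp del: minus_diff_eq intro: add_nonneg_nonneg)
  also have "\<dots> = exp (\<Sum>p\<in>primes_upto y. real p powr (-(1 - \<epsilon>)))" by (simp add: exp_sum)
  also have "(\<Sum>p\<in>primes_upto y. real p powr (-(1 - \<epsilon>))) \<le> (\<Sum>p\<in>primes_upto y. y powr \<epsilon> * inverse (real p))"
  proof (rule sum_mono)
    fix p assume p: "p \<in> primes_upto y"
    have "real p > 0" "real p \<le> y" using p primes_uptoD[OF p] by (auto simp: primes_upto_def)
    then have "real p powr \<epsilon> \<le> y powr \<epsilon>" using assms by (intro powr_mono2) auto
    moreover have "real p powr (-(1 - \<epsilon>)) = real p powr \<epsilon> * inverse (real p)"
      using \<open>real p > 0\<close> by (simp add: powr_diff divide_inverse)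
    ultimately show "real p powr (-(1 - \<epsilon>)) \<le> y powr \<epsilon> * inverse (real p)"
      by (simp add: mult_right_mono)
  qed
  also have "\<dots> = y powr \<epsilon> * (\<Sum>p\<in>primes_upto y. inverse (real p))" by (simp add: sum_distrib_left)
  also have "(\<Sum>p\<in>primes_upto y. inverse (real p)) \<le> harm (nat \<lfloor>y\<rfloor>)"
    unfolding harm_def by (intro sum_mono2)
      (auto simp: primes_upto_def le_nat_floor Suc_le_eq prime_gt_0_nat)
  also have "harm (nat \<lfloor>y\<rfloor>) \<le> 1 + ln (real (nat \<lfloor>y\<rfloor>))"
    using assms by (intro harm_le_one_plus_ln) linarith
  also have "ln (real (nat \<lfloor>y\<rfloor>)) \<le> ln y"
    using assms by (intro ln_mono) linarith+
  finally show ?thesis by (simp add: mult_left_mono)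
qed

subsection \<open>Squarefree numbers\<close>

definition squarefree_upto :: "real \<Rightarrow> nat set" where
  "squarefree_upto z = {a. squarefree a \<and> real a \<le> z}"

lemma finite_squarefree_upto [simp, intro]: "finite (squarefree_upto z)"
  by (rule finite_subset[of _ "{..nat \<lfloor>z\<rfloor>}"]) (auto simp: squarefree_upto_def le_nat_floor)

lemma squarefree_nat_pos: "squarefree (a::nat) \<Longrightarrow> a > 0"
  by (rule Nat.gr0I) auto

text \<open>Every \<open>n \<le> z\<close> is a squarefree number times a square, and the
  reciprocals of the squares sum to at most \<open>pi\<^sup>2 / 6\<close>.\<close>

lemma harm_le_squarefree_sum:
  "harm (nat \<lfloor>z\<rfloor>) \<le> pi\<^sup>2 / 6 * (\<Sum>a\<in>squarefree_upto z. 1 / real a)"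
proof -
  define N where "N = nat \<lfloor>z\<rfloor>"
  have "harm N = (\<Sum>n\<in>{1..N}. 1 / real n)" by (simp add: harm_def divide_inverse)
  also have "\<dots> \<le> (\<Sum>(a,b)\<in>squarefree_upto z \<times> {1..N}. 1 / real a * (1 / real b ^ 2))"
  proof (rule sum_le_included[where i = "\<lambda>(a,b). a * b ^ 2"])
    show "\<forall>n\<in>{1..N}. \<exists>y\<in>squarefree_upto z \<times> {1..N}. (case y of (a, b) \<Rightarrow> a * b ^ 2) = n \<and>
        1 / real n \<le> (case y of (a, b) \<Rightarrow> 1 / real a * (1 / real b ^ 2))"
    proof
      fix n assume n: "n \<in> {1..N}"
      let ?a = "squarefree_part n" and ?b = "square_part n"
      have eq: "n = ?a * ?b ^ 2" by (rule squarefree_decompose)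
      have "?a dvd n" "?b dvd n" using eq by (metis dvd_triv_left, metis dvd_def mult.commute power2_eq_square mult.assoc)
      then have "?a \<le> n" "?b \<le> n" using n by (auto intro: dvd_imp_le)
      moreover have "?b > 0" using n by (intro Nat.gr0I) auto
      moreover have "real n \<le> z" using n unfolding N_def by simp linarith
      ultimately have "(?a, ?b) \<in> squarefree_upto z \<times> {1..N}"
        using n by (auto simp: squarefree_upto_def)
      moreover have "1 / real n = 1 / real ?a * (1 / real ?b ^ 2)"
        by (subst eq) simp
      ultimately show "\<exists>y\<in>squarefree_upto z \<times> {1..N}. (case y of (a, b) \<Rightarrow> a * b ^ 2) = n \<and>
        1 / real n \<le> (case y of (a, b) \<Rightarrow> 1 / real a * (1 / real b ^ 2))"
        using eq by (intro bexI[of _ "(?a, ?b)"]) auto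
    qed
  qed auto
  also have "\<dots> = (\<Sum>a\<in>squarefree_upto z. 1 / real a) * (\<Sum>b\<in>{1..N}. 1 / real b ^ 2)"
    by (simp add: sum_product sum.cartesian_product)
  also have "\<dots> \<le> (\<Sum>a\<in>squarefree_upto z. 1 / real a) * (pi\<^sup>2 / 6)"
  proof (rule mult_left_mono)
    have "(\<Sum>b\<in>{1..N}. 1 / real b ^ 2) = (\<Sum>n<N. 1 / (real n + 1)\<^sup>2)"
    by (rule sum.reindex_bij_witness[of _ Suc "\<lambda>b. b - 1"]) auto
  also have "\<dots> \<le> pi\<^sup>2 / 6"
    using inverse_squares_sums sum_le_suminf[of "\<lambda>n. 1 / (real n + 1)\<^sup>2" "{..<N}"]
      by (simp add: sums_iff add.commute)
    finally show "(\<Sum>b\<in>{1..N}. 1 / real b ^ 2) \<le> pi\<^sup>2 / 6" .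
  qed (auto intro: sum_nonneg)
  finally show ?thesis by (simp add: N_def mult.commute)
qed

text \<open>Uniqueness of that decomposition: a prime divides \<open>a\<close> at most once, which
  is lost when the exponent is halved and rounded down.\<close>

lemma square_part_squarefree_mult_square:
  fixes a b :: nat
  assumes "squarefree a" "b > 0"
  shows "square_part (a * b ^ 2) = b"
proof (rule multiplicity_eq_nat)
  have a: "a > 0" using assms squarefree_nat_pos by auto
  then show "square_part (a * b ^ 2) > 0" using assms by (intro Nat.gr0I) auto
  fix p :: nat assume p: "prime p"
  have "multiplicity p a \<le> 1" using assms p a by (auto simp: squarefree_factorial_semiring''[of a])
  then show "multiplicity p (square_part (a * b ^ 2)) = multiplicity p b"
    using a assms p
    by (simp add: prime_multiplicity_square_part prime_elem_multiplicity_mult_distrib prime_elem_multiplicity_power_distrib)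
qed (use assms in auto)

text \<open>The converse comparison: the products \<open>a * b ^ 2\<close> are distinct. Capping
  \<open>b\<close> at a fixed \<open>B\<close> keeps them below a constant multiple of
  \<open>z\<close>.\<close>

lemma squarefree_sum_le_harm:
  assumes "B \<ge> 1"
  shows "(\<Sum>n<B. 1 / (real n + 1)\<^sup>2) * (\<Sum>a\<in>squarefree_upto z. 1 / real a) \<le> harm (nat \<lfloor>z * real B ^ 2\<rfloor>)"
proof -
  have inj: "inj_on (\<lambda>(a,b). a * b ^ 2) (squarefree_upto z \<times> {1..B})"
  proof (rule inj_onI, clarify)
    fix a b a' b' :: nat
    assume *: "a \<in> squarefree_upto z" "a' \<in> squarefree_upto z" "b \<in> {1..B}" "b' \<in> {1..B}"
      and eq: "a * b ^ 2 = a' * b' ^ 2"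
    have "square_part (a * b ^ 2) = b" "square_part (a' * b' ^ 2) = b'"
      using * by (auto intro!: square_part_squarefree_mult_square simp: squarefree_upto_def)
    then have "b = b'" using eq by simp
    with eq * show "a = a' \<and> b = b'" by auto
  qed
  have "(\<Sum>n<B. 1 / (real n + 1)\<^sup>2) = (\<Sum>b\<in>{1..B}. 1 / real b ^ 2)"
    by (rule sum.reindex_bij_witness[of _ "\<lambda>b. b - 1" Suc]) auto
  from this[THEN arg_cong, of "\<lambda>t. (\<Sum>a\<in>squarefree_upto z. 1 / real a) * t"] have "(\<Sum>n<B. 1 / (real n + 1)\<^sup>2) * (\<Sum>a\<in>squarefree_upto z. 1 / real a) =
      (\<Sum>(a,b)\<in>squarefree_upto z \<times> {1..B}. 1 / real (a * b ^ 2))"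
    by (simp add: sum_product sum.cartesian_product mult.commute)
  also have "\<dots> = (\<Sum>n\<in>(\<lambda>(a,b). a * b ^ 2) ` (squarefree_upto z \<times> {1..B}). 1 / real n)"
    by (subst sum.reindex[OF inj]) (auto simp: case_prod_unfold)
  also have "\<dots> \<le> (\<Sum>n\<in>{1..nat \<lfloor>z * real B ^ 2\<rfloor>}. 1 / real n)"
  proof (intro sum_mono2 subsetI)
    fix n assume "n \<in> (\<lambda>(a,b). a * b ^ 2) ` (squarefree_upto z \<times> {1..B})"
    then obtain a b where n: "n = a * b ^ 2" "squarefree a" "real a \<le> z" "1 \<le> b" "b \<le> B"
      by (auto simp: squarefree_upto_def)
    have "real n = real a * real b ^ 2" by (simp add: n)
    also have "\<dots> \<le> z * real B ^ 2" using n by (intro mult_mono power_mono) auto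
    finally show "n \<in> {1..nat \<lfloor>z * real B ^ 2\<rfloor>}"
      using n squarefree_nat_pos[of a] by (auto simp: le_nat_floor Suc_le_eq)
  qed auto
  finally show ?thesis by (simp add: harm_def divide_inverse)
qed

text \<open>The lower bound holds for every \<open>z \<ge> 2\<close>. For the upper bound
  \<open>B\<close> is fixed first, so that \<open>ln (z * B ^ 2) / ln z\<close> tends to 1, and is
  chosen so large that the partial sum of the inverse squares is close to its limit.\<close>

lemma squarefree_sum_asymp:
  "((\<lambda>z. (\<Sum>a\<in>squarefree_upto z. 1 / real a) / ln z) \<longlongrightarrow> 6 / pi\<^sup>2) at_top"
proof (rule order_tendstoI)
  let ?S = "\<lambda>z. \<Sum>a\<in>squarefree_upto z. 1 / real a"
  have lower: "6 / pi\<^sup>2 \<le> ?S z / ln z" if "z \<ge> 2" for z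
  proof -
    have "ln z \<le> ln (real (nat \<lfloor>z\<rfloor>) + 1)" using that by (intro ln_mono) linarith+
    also have "\<dots> \<le> harm (nat \<lfloor>z\<rfloor>)" by (rule ln_le_harm)
    also have "\<dots> \<le> pi\<^sup>2 / 6 * ?S z" by (rule harm_le_squarefree_sum)
    finally show ?thesis using that by (simp add: field_simps)
  qed
  show "\<forall>\<^sub>F z in at_top. u < ?S z / ln z" if "u < 6 / pi\<^sup>2" for u
    using eventually_ge_at_top[of 2] by eventually_elim (use that lower in force)
  show "\<forall>\<^sub>F z in at_top. ?S z / ln z < u" if u: "6 / pi\<^sup>2 < u" for u
  proof -
    define Z where "Z B = (\<Sum>n<B. 1 / (real n + 1)\<^sup>2)" for B
    have "Z \<longlonglongrightarrow> pi\<^sup>2 / 6"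
      using inverse_squares_sums unfolding sums_def Z_def by (simp add: add_ac)
    then have "(\<lambda>B. 1 / Z B) \<longlonglongrightarrow> 1 / (pi\<^sup>2 / 6)" by (intro tendsto_intros) auto
    then have "\<forall>\<^sub>F B in sequentially. 1 / Z B < u" using u by (intro order_tendstoD) auto
    then have "\<forall>\<^sub>F B in sequentially. 1 / Z B < u \<and> B \<ge> 1" using eventually_ge_at_top[of 1]
      by eventually_elim auto
    then obtain B where B: "1 / Z B < u" "B \<ge> 1" by (auto dest: eventually_happens)
    have ZB: "Z B > 0" unfolding Z_def using B by (intro sum_pos) (auto simp: lessThan_empty_iff)
    have "((\<lambda>z. (1 + ln (z * real B ^ 2)) / ln z / Z B) \<longlongrightarrow> 1 / Z B) at_top"
    proof -
      have "((\<lambda>z. (1 + ln (z * real B ^ 2)) / ln z) \<longlongrightarrow> 1) at_top" using B by real_asymp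
      then show ?thesis using ZB by (intro tendsto_intros) auto
    qed
    then have "\<forall>\<^sub>F z in at_top. (1 + ln (z * real B ^ 2)) / ln z / Z B < u"
      using B by (intro order_tendstoD) auto
    then show ?thesis using eventually_ge_at_top[of 2]
    proof eventually_elim
      case (elim z)
      have zB: "z * real B ^ 2 \<ge> 2 * 1" using elim B by (intro mult_mono) auto
      have "Z B * ?S z \<le> harm (nat \<lfloor>z * real B ^ 2\<rfloor>)"
        unfolding Z_def by (rule squarefree_sum_le_harm[OF B(2)])
      also have "\<dots> \<le> 1 + ln (real (nat \<lfloor>z * real B ^ 2\<rfloor>))"
        using zB by (intro harm_le_one_plus_ln) linarith
      also have "\<dots> \<le> 1 + ln (z * real B ^ 2)" using zB by (intro add_left_mono ln_mono) linarith+
      finally have "?S z / ln z \<le> (1 + ln (z * real B ^ 2)) / ln z / Z B"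
        using elim ZB by (simp add: field_simps)
      then show ?case using elim by linarith
    qed
  qed
qed

subsection \<open>Products of a small squarefree number and a rough number\<close>

definition large_squarefree_upto :: "real \<Rightarrow> nat set" where
  "large_squarefree_upto z = {a \<in> squarefree_upto z. 3 \<le> a}"

text \<open>This counts pairs of a number \<open>a\<close> and a rough cofactor, not their products.
  Overcounting is harmless in an upper bound; the lower bound relies on
  \<open>smooth_rough_product_inj\<close>.\<close>

definition factored_count :: "real \<Rightarrow> real \<Rightarrow> real \<Rightarrow> real" where
  "factored_count x z y = (\<Sum>a\<in>large_squarefree_upto z. real (card (sifted (primes_upto y) (x / real a))))"

lemma finite_large_squarefree_upto [simp, intro]: "finite (large_squarefree_upto z)"
  by (auto simp: large_squarefree_upto_def)

lemma card_large_squarefree_upto_le: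
  assumes "z \<ge> 0"
  shows "real (card (large_squarefree_upto z)) \<le> z"
proof -
  have "large_squarefree_upto z \<subseteq> {1..nat \<lfloor>z\<rfloor>}"
    by (auto simp: large_squarefree_upto_def squarefree_upto_def le_nat_floor)
  then have "card (large_squarefree_upto z) \<le> card {1..nat \<lfloor>z\<rfloor>}" by (intro card_mono) auto
  then show ?thesis using assms by simp linarith
qed

text \<open>The subtracted constant is \<open>1 + 1 / 2\<close>, from the squarefree numbers below
  3.\<close>

lemma large_squarefree_sum:
  assumes "z \<ge> 2"
  shows "(\<Sum>a\<in>large_squarefree_upto z. 1 / real a) = (\<Sum>a\<in>squarefree_upto z. 1 / real a) - 3 / 2"
proof -
  have "squarefree (2::nat)" by (rule squarefree_prime) auto
  then have "squarefree_upto z = large_squarefree_upto z \<union> {1, 2}"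
    using assms squarefree_nat_pos
    by (auto simp: large_squarefree_upto_def squarefree_upto_def) (metis One_nat_def Suc_1 Suc_leI le_neq_implies_less numeral_3_eq_3)
  moreover have "large_squarefree_upto z \<inter> {1, 2} = {}" by (auto simp: large_squarefree_upto_def)
  ultimately show ?thesis by (simp add: sum.union_disjoint)
qed

text \<open>The sieve estimate is summed over at most \<open>z\<close> values of \<open>a\<close>,
  with each individual error bounded by the one at \<open>x\<close>.\<close>

lemma factored_count_error:
  assumes "x > 0" "z \<ge> 2" "y \<ge> 1" "0 \<le> \<epsilon>" "\<epsilon> \<le> 1"
  shows "\<bar>factored_count x z y / x - Mertens_prod y * ((\<Sum>a\<in>squarefree_upto z. 1 / real a) - 3 / 2)\<bar> \<le>
           z * x powr (-\<epsilon>) * exp (y powr \<epsilon> * (1 + ln y))"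
proof -
  let ?I = "large_squarefree_upto z" and ?E = "exp (y powr \<epsilon> * (1 + ln y))"
  have "\<bar>factored_count x z y - x * Mertens_prod y * (\<Sum>a\<in>?I. 1 / real a)\<bar> =
      \<bar>\<Sum>a\<in>?I. real (card (sifted (primes_upto y) (x / real a))) - x / real a * Mertens_prod y\<bar>"
    by (simp add: factored_count_def sum_subtractf sum_distrib_left mult_ac)
  also have "\<dots> \<le> (\<Sum>a\<in>?I. \<bar>real (card (sifted (primes_upto y) (x / real a))) - x / real a * Mertens_prod y\<bar>)"
    by (rule sum_abs)
  also have "\<dots> \<le> (\<Sum>a\<in>?I. x powr (1 - \<epsilon>) * ?E)"
  proof (rule sum_mono)
    fix a assume a: "a \<in> ?I"
    have "\<bar>real (card (sifted (primes_upto y) (x / real a))) - x / real a * Mertens_prod y\<bar> \<le>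
        (x / real a) powr (1 - \<epsilon>) * ?E"
      using assms by (intro card_sifted_primes_upto) auto
    also have "(x / real a) powr (1 - \<epsilon>) \<le> x powr (1 - \<epsilon>)"
      using a assms by (intro powr_mono2) (auto simp: large_squarefree_upto_def field_simps)
    finally show "\<bar>real (card (sifted (primes_upto y) (x / real a))) - x / real a * Mertens_prod y\<bar> \<le>
        x powr (1 - \<epsilon>) * ?E" by (simp add: mult_right_mono)
  qed
  also have "\<dots> = real (card ?I) * (x powr (1 - \<epsilon>) * ?E)" by simp
  also have "\<dots> \<le> z * (x powr (1 - \<epsilon>) * ?E)"
    using assms by (intro mult_right_mono card_large_squarefree_upto_le) auto
  finally have "\<bar>factored_count x z y - x * Mertens_prod y * (\<Sum>a\<in>?I. 1 / real a)\<bar> / x \<le>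
      z * (x powr (1 - \<epsilon>) * ?E) / x" using assms by (intro divide_right_mono) auto
  also have "x powr (1 - \<epsilon>) = x * x powr (-\<epsilon>)" using assms by (simp add: powr_diff powr_minus_divide)
  also have "z * (x * x powr (-\<epsilon>) * ?E) / x = z * x powr (-\<epsilon>) * ?E" using assms by simp
  finally have "\<bar>(factored_count x z y - x * Mertens_prod y * (\<Sum>a\<in>?I. 1 / real a)) / x\<bar> \<le>
      z * x powr (-\<epsilon>) * ?E" using assms by simp
  moreover have "(factored_count x z y - x * Mertens_prod y * (\<Sum>a\<in>?I. 1 / real a)) / x =
      factored_count x z y / x - Mertens_prod y * (\<Sum>a\<in>?I. 1 / real a)"
    using assms by (simp add: diff_divide_distrib)
  ultimately have "\<bar>factored_count x z y / x - Mertens_prod y * (\<Sum>a\<in>?I. 1 / real a)\<bar> \<le>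
      z * x powr (-\<epsilon>) * ?E" by (simp only:)
  then show ?thesis unfolding large_squarefree_sum[OF assms(2)] .
qed

text \<open>The scale factors \<open>a\<close> and \<open>b\<close> allow \<open>ln N\<close> and
  \<open>ln N / 2\<close> in either place; they disappear from the limit.\<close>

lemma factored_count_asymp:
  fixes a b C :: real
  assumes "0 < a" "a \<le> 1" "0 < b" "b \<le> 1" "C > 1 / 2"
  shows "(\<lambda>N. factored_count (real N) ((a * ln (real N)) powr 0.1) ((b * ln (real N)) powr C) / real N)
           \<longlonglongrightarrow> exp (- euler_mascheroni) * (3 / (5 * pi\<^sup>2 * C))"
proof -
  define z where "z N = (a * ln (real N)) powr 0.1" for N :: nat
  define y where "y N = (b * ln (real N)) powr C" for N :: nat
  define S where "S z = (\<Sum>a\<in>squarefree_upto z. 1 / real a)" for z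
  \<comment> \<open>Chosen so that \<open>y N powr \<epsilon>\<close> is
    \<open>(b * ln N) powr (1/2)\<close>; \<open>C > 1 / 2\<close> ensures
    \<open>\<epsilon> \<le> 1\<close>.\<close>
  define \<epsilon> where "\<epsilon> = 1 / (2 * C)"
  have \<epsilon>: "0 < \<epsilon>" "\<epsilon> \<le> 1" "C * \<epsilon> = 1 / 2" using assms by (auto simp: \<epsilon>_def field_simps)
  have z_top: "filterlim z at_top sequentially" unfolding z_def using assms by real_asymp
  have y_top: "filterlim y at_top sequentially" unfolding y_def using assms by real_asymp
  have ev: "\<forall>\<^sub>F N in sequentially. N \<ge> 3 \<and> z N \<ge> 2 \<and> y N \<ge> 2"
    using eventually_ge_at_top[of 3] filterlim_at_top[THEN iffD1, OF z_top, rule_format, of 2]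
      filterlim_at_top[THEN iffD1, OF y_top, rule_format, of 2] by eventually_elim auto
  have main: "(\<lambda>N. Mertens_prod (y N) * (S (z N) - 3 / 2)) \<longlonglongrightarrow> exp (- euler_mascheroni) * (6 / pi\<^sup>2 * (inverse C / 10) - 0)"
  proof (rule Lim_transform_eventually)
    have 1: "(\<lambda>N. Mertens_prod (y N) * ln (y N)) \<longlonglongrightarrow> exp (- euler_mascheroni)"
      by (rule filterlim_compose[OF Mertens_third y_top])
    have 2: "(\<lambda>N. S (z N) / ln (z N)) \<longlonglongrightarrow> 6 / pi\<^sup>2"
      unfolding S_def by (rule filterlim_compose[OF squarefree_sum_asymp z_top])
    \<comment> \<open>The quotient of the exponents 0.1 and \<open>C\<close>; together with
      \<open>6 / pi\<^sup>2\<close> it gives the rational factor 3 / 5 of the density.\<close>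
    have 3: "(\<lambda>N. ln (z N) / ln (y N)) \<longlonglongrightarrow> inverse C / 10"
    proof -
      have "(\<lambda>N. (0.1 * ln (a * ln (real N))) / (C * ln (b * ln (real N)))) \<longlonglongrightarrow> inverse C / 10"
        using assms by real_asymp
      moreover have "\<forall>\<^sub>F N in sequentially. (0.1 * ln (a * ln (real N))) / (C * ln (b * ln (real N))) = ln (z N) / ln (y N)"
        using ev by eventually_elim (use assms in \<open>simp add: z_def y_def ln_powr\<close>)
      ultimately show ?thesis by (rule Lim_transform_eventually)
    qed
    have 4: "(\<lambda>N. 3 / 2 / ln (y N)) \<longlonglongrightarrow> 0" unfolding y_def using assms by real_asymp
    show "(\<lambda>N. Mertens_prod (y N) * ln (y N) * (S (z N) / ln (z N) * (ln (z N) / ln (y N)) - 3 / 2 / ln (y N)))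
        \<longlonglongrightarrow> exp (- euler_mascheroni) * (6 / pi\<^sup>2 * (inverse C / 10) - 0)"
      by (intro tendsto_mult tendsto_diff 1 2 3 4)
    show "\<forall>\<^sub>F N in sequentially. Mertens_prod (y N) * ln (y N) * (S (z N) / ln (z N) * (ln (z N) / ln (y N)) - 3 / 2 / ln (y N)) =
        Mertens_prod (y N) * (S (z N) - 3 / 2)"
      using ev
    proof eventually_elim
      case (elim N)
      have "ln (z N) > 0" "ln (y N) > 0" using elim by auto
      then show ?case by (simp add: field_simps)
    qed
  qed
  have err: "(\<lambda>N. factored_count (real N) (z N) (y N) / real N - Mertens_prod (y N) * (S (z N) - 3 / 2)) \<longlonglongrightarrow> 0"
  proof (rule tendsto_rabs_zero_cancel, rule tendsto_sandwich[OF _ _ tendsto_const])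
    \<comment> \<open>With \<open>u = ln N\<close> the positive exponent is of order
      \<open>sqrt u * ln u\<close>, which is dominated by \<open>\<epsilon> * u\<close>.\<close>
    have "((\<lambda>u. u powr 0.1 * exp (- (\<epsilon> * u)) * exp (u powr (1/2) * (1 + C * ln u))) \<longlongrightarrow> 0) at_top"
      using \<epsilon> assms by real_asymp
    moreover have "filterlim (\<lambda>N. ln (real N)) at_top sequentially" by real_asymp
    ultimately show "(\<lambda>N. ln (real N) powr 0.1 * exp (- (\<epsilon> * ln (real N))) *
        exp (ln (real N) powr (1/2) * (1 + C * ln (ln (real N))))) \<longlonglongrightarrow> 0"
      by (rule filterlim_compose)
    show "\<forall>\<^sub>F N in sequentially. \<bar>factored_count (real N) (z N) (y N) / real N - Mertens_prod (y N) * (S (z N) - 3 / 2)\<bar> \<le>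
      ln (real N) powr 0.1 * exp (- (\<epsilon> * ln (real N))) * exp (ln (real N) powr (1/2) * (1 + C * ln (ln (real N))))"
      using ev
    proof eventually_elim
      case (elim N)
      have l: "ln (real N) > 0" using elim by auto
      have al: "a * ln (real N) \<le> ln (real N)" "b * ln (real N) \<le> ln (real N)" "a * ln (real N) > 0" "b * ln (real N) > 0"
        using l assms by auto
      have "\<bar>factored_count (real N) (z N) (y N) / real N - Mertens_prod (y N) * (S (z N) - 3 / 2)\<bar> \<le>
          z N * real N powr (-\<epsilon>) * exp (y N powr \<epsilon> * (1 + ln (y N)))"
        unfolding S_def using elim \<epsilon> by (intro factored_count_error) auto
      also have "\<dots> \<le> ln (real N) powr 0.1 * real N powr (-\<epsilon>) * exp (ln (real N) powr (1/2) * (1 + C * ln (ln (real N))))"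
      proof (intro mult_mono exp_le_cancel_iff[THEN iffD2] add_left_mono)
        show "z N \<le> ln (real N) powr 0.1" unfolding z_def using al by (intro powr_mono2) auto
        have "y N powr \<epsilon> = (b * ln (real N)) powr (1/2)" unfolding y_def by (simp add: powr_powr \<epsilon>)
        also have "\<dots> \<le> ln (real N) powr (1/2)" using al by (intro powr_mono2) auto
        finally show "y N powr \<epsilon> \<le> ln (real N) powr (1/2)" .
        have "ln (y N) = C * ln (b * ln (real N))" using al by (simp add: y_def ln_powr)
        also have "\<dots> \<le> C * ln (ln (real N))" using al assms by (intro mult_left_mono ln_mono) auto
        finally show "ln (y N) \<le> C * ln (ln (real N))" .
      qed (use elim in auto)
      also have "real N powr (-\<epsilon>) = exp (- (\<epsilon> * ln (real N)))" using elim by (simp add: powr_def)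
      finally show ?case .
    qed
  qed auto
  from tendsto_add[OF err main]
  have "(\<lambda>N. factored_count (real N) (z N) (y N) / real N) \<longlonglongrightarrow> exp (- euler_mascheroni) * (6 / pi\<^sup>2 * (inverse C / 10))"
    by simp
  also have "6 / pi\<^sup>2 * (inverse C / 10) = 3 / (5 * pi\<^sup>2 * C)" using assms by (simp add: field_simps)
  finally show ?thesis unfolding z_def y_def .
qed

subsection \<open>The density\<close>

lemma prime_dvd_least_prime_divisor:
  assumes "m > 1"
  shows "prime (least_prime_divisor m) \<and> least_prime_divisor m dvd m"
  unfolding least_prime_divisor_def by (rule LeastI_ex) (use assms prime_factor_nat[of m] in auto)

lemma least_prime_divisor_le: "prime p \<Longrightarrow> p dvd m \<Longrightarrow> least_prime_divisor m \<le> p"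
  unfolding least_prime_divisor_def by (rule Least_le) auto

lemma half_ln_less:
  assumes "N > 0" "sqrt (real N) < real M"
  shows "ln (real N) / 2 < ln (real M)"
proof -
  have "sqrt (real N) > 0" using assms by simp
  then have "ln (sqrt (real N)) < ln (real M)" using assms(2) by (subst ln_less_cancel_iff) linarith+
  then show ?thesis using assms by (simp add: ln_sqrt)
qed

text \<open>For \<open>M\<close> above \<open>sqrt N\<close> the logarithm lies between
  \<open>ln N / 2\<close> and \<open>ln N\<close>. Taking the larger value in the bound on
  \<open>A\<close> and the smaller one in the bound on the primes of \<open>m\<close> only enlarges
  the set.\<close>

lemma card_Omega_set_le:
  assumes N: "N \<ge> 3" and C: "C \<ge> 0"
  shows "real (card {n \<in> Omega_set C M0. n \<le> N}) \<le>
    sqrt (real N) + factored_count (real N) (ln (real N) powr 0.1) ((ln (real N) / 2) powr C)"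
proof -
  define z where "z = ln (real N) powr 0.1"
  define y where "y = (ln (real N) / 2) powr C"
  define F where "F a = (\<lambda>m. a * m) ` sifted (primes_upto y) (real N / real a)" for a
  have lN: "ln (real N) > 0" using N by simp
  have "{n \<in> Omega_set C M0. n \<le> N} \<subseteq> {1..nat \<lfloor>sqrt (real N)\<rfloor>} \<union> (\<Union>a\<in>large_squarefree_upto z. F a)"
  proof
    fix M assume "M \<in> {n \<in> Omega_set C M0. n \<le> N}"
    then obtain a m where M: "M > 0" "squarefree M" "M \<le> N" "M = a * m" "3 \<le> a"
        "real a \<le> ln (real M) powr 0.1" "ln (real M) powr C < real (least_prime_divisor m)"
      by (auto simp: Omega_set_def)
    show "M \<in> {1..nat \<lfloor>sqrt (real N)\<rfloor>} \<union> (\<Union>a\<in>large_squarefree_upto z. F a)"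
    proof (cases "real M \<le> sqrt (real N)")
      case True
      then show ?thesis using M by (auto simp: le_nat_floor)
    next
      case False
      have half: "ln (real N) / 2 < ln (real M)" using half_ln_less[of N M] False N by simp
      have "ln (real M) \<le> ln (real N)" using M(1,3) by (intro ln_mono) auto
      then have "ln (real M) powr 0.1 \<le> z" unfolding z_def using half lN by (intro powr_mono2) auto
      moreover have "squarefree a" using M(2,4) squarefree_multD(1) by blast
      ultimately have a: "a \<in> large_squarefree_upto z"
        using M by (auto simp: large_squarefree_upto_def squarefree_upto_def)
      have "y \<le> ln (real M) powr C" unfolding y_def using half lN C by (intro powr_mono2) auto
      then have "\<not> p dvd m" if "p \<in> primes_upto y" for p
        using that M(7) least_prime_divisor_le[of p m] by (force simp: primes_upto_def)
      moreover have "real m \<le> real N / real a"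
        using M by (simp add: field_simps flip: of_nat_mult)
      ultimately have "m \<in> sifted (primes_upto y) (real N / real a)"
        using M by (auto simp: sifted_def intro: Nat.gr0I)
      then have "M \<in> F a" using M(4) by (auto simp: F_def)
      then show ?thesis using a by blast
    qed
  qed
  then have "card {n \<in> Omega_set C M0. n \<le> N} \<le>
      card ({1..nat \<lfloor>sqrt (real N)\<rfloor>} \<union> (\<Union>a\<in>large_squarefree_upto z. F a))"
    by (intro card_mono) (auto simp: F_def)
  also have "\<dots> \<le> card {1..nat \<lfloor>sqrt (real N)\<rfloor>} + card (\<Union>a\<in>large_squarefree_upto z. F a)"
    by (rule card_Un_le)
  also have "card (\<Union>a\<in>large_squarefree_upto z. F a) \<le> (\<Sum>a\<in>large_squarefree_upto z. card (F a))"
    by (rule card_UN_le) auto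
  also have "\<dots> \<le> (\<Sum>a\<in>large_squarefree_upto z. card (sifted (primes_upto y) (real N / real a)))"
    unfolding F_def by (intro sum_mono card_image_le) auto
  finally have "card {n \<in> Omega_set C M0. n \<le> N} \<le> nat \<lfloor>sqrt (real N)\<rfloor> +
      (\<Sum>a\<in>large_squarefree_upto z. card (sifted (primes_upto y) (real N / real a)))"
    by simp
  from of_nat_mono[OF this, where ?'a = real]
  have "real (card {n \<in> Omega_set C M0. n \<le> N}) \<le> real (nat \<lfloor>sqrt (real N)\<rfloor>) +
      real (\<Sum>a\<in>large_squarefree_upto z. card (sifted (primes_upto y) (real N / real a)))"
    by (simp only: of_nat_add)
  also have "real (nat \<lfloor>sqrt (real N)\<rfloor>) \<le> sqrt (real N)" by simp
  finally show ?thesis unfolding factored_count_def z_def y_def by simp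
qed

lemma sum_inverse_squares_tail:
  assumes "k \<ge> 1"
  shows "(\<Sum>d\<in>{Suc k..n}. 1 / real d ^ 2) \<le> 1 / real k"
proof (cases "n \<ge> k")
  case True
  then have "(\<Sum>d\<in>{Suc k..n}. 1 / real d ^ 2) \<le> 1 / real k - 1 / real n"
  proof (induction n rule: dec_induct)
    case (step n)
    have n: "real n > 0" using step assms by simp
    then have "1 / real (Suc n) ^ 2 \<le> 1 / real n - 1 / real (Suc n)"
      by (simp add: divide_simps power2_eq_square)
    moreover have "{Suc k..Suc n} = insert (Suc n) {Suc k..n}" using step by auto
    ultimately show ?case using step.IH by simp
  qed auto
  moreover have "1 / real n \<ge> 0" by simp
  ultimately show ?thesis by linarith
qed auto

text \<open>Union bound over \<open>d\<close>; passing from \<open>y\<close> to its integer part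
  accounts for the 1 in the denominator. It disposes of cofactors that are not squarefree.\<close>

lemma card_large_square_divisor:
  assumes y: "y > 1"
  shows "real (card {M\<in>{1..N}. \<exists>d. y < real d \<and> d ^ 2 dvd M}) \<le> real N / (y - 1)"
proof -
  define k where "k = nat \<lfloor>y\<rfloor>"
  have k: "k \<ge> 1" "y - 1 \<le> real k" using y unfolding k_def by linarith+
  have "{M\<in>{1..N}. \<exists>d. y < real d \<and> d ^ 2 dvd M} \<subseteq> (\<Union>d\<in>{Suc k..N}. {M\<in>{1..N}. d ^ 2 dvd M})"
  proof
    fix M assume "M \<in> {M\<in>{1..N}. \<exists>d. y < real d \<and> d ^ 2 dvd M}"
    then obtain d where d: "M \<in> {1..N}" "y < real d" "d ^ 2 dvd M" by auto
    have "d \<le> d ^ 2" by (cases d) (auto simp: power2_eq_square)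
    also have "d ^ 2 \<le> M" using d by (intro dvd_imp_le) auto
    finally have "d \<le> N" using d by auto
    moreover have "Suc k \<le> d" using d y unfolding k_def by linarith
    ultimately show "M \<in> (\<Union>d\<in>{Suc k..N}. {M\<in>{1..N}. d ^ 2 dvd M})" using d by auto
  qed
  then have "card {M\<in>{1..N}. \<exists>d. y < real d \<and> d ^ 2 dvd M} \<le> card (\<Union>d\<in>{Suc k..N}. {M\<in>{1..N}. d ^ 2 dvd M})"
    by (intro card_mono) auto
  also have "\<dots> \<le> (\<Sum>d\<in>{Suc k..N}. card {M\<in>{1..N}. d ^ 2 dvd M})" by (rule card_UN_le) auto
  also have "\<dots> = (\<Sum>d\<in>{Suc k..N}. N div d ^ 2)" by (intro sum.cong refl card_multiples_upto) auto
  finally have "real (card {M\<in>{1..N}. \<exists>d. y < real d \<and> d ^ 2 dvd M}) \<le> (\<Sum>d\<in>{Suc k..N}. real (N div d ^ 2))"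
    by (simp flip: of_nat_sum)
  also have "\<dots> \<le> (\<Sum>d\<in>{Suc k..N}. real N * (1 / real d ^ 2))"
    using real_div_le[of N "d ^ 2" for d] by (intro sum_mono) simp
  also have "\<dots> = real N * (\<Sum>d\<in>{Suc k..N}. 1 / real d ^ 2)" by (simp add: sum_distrib_left)
  also have "\<dots> \<le> real N * (1 / real k)" by (intro mult_left_mono sum_inverse_squares_tail k) auto
  also have "\<dots> \<le> real N * (1 / (y - 1))" using k y by (intro mult_left_mono divide_left_mono) auto
  finally show ?thesis by simp
qed

text \<open>Prime factors of \<open>a\<close> are at most \<open>z \<le> y\<close>, those of a
  sifted number exceed \<open>y\<close>. Hence \<open>a\<close> is coprime to \<open>m'\<close>, and
  \<open>a * m = a' * m'\<close> forces \<open>a\<close> and \<open>a'\<close> to divide each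
  other.\<close>

lemma smooth_rough_product_inj:
  assumes zy: "z \<le> y"
  shows "inj_on (\<lambda>(a, m). a * m) (SIGMA a:large_squarefree_upto z. sifted (primes_upto y) (x / real a))"
proof (rule inj_onI, clarify)
  fix a m a' m' :: nat
  assume a: "a \<in> large_squarefree_upto z" and a': "a' \<in> large_squarefree_upto z"
    and m: "m \<in> sifted (primes_upto y) (x / real a)" and m': "m' \<in> sifted (primes_upto y) (x / real a')"
    and eq: "a * m = a' * m'"
  have cop: "coprime b n" if b: "b \<in> large_squarefree_upto z" and n: "\<forall>p\<in>primes_upto y. \<not> p dvd n" for b n
  proof (rule ccontr)
    assume "\<not> coprime b n"
    then obtain p where p: "prime p" "p dvd b" "p dvd n"
      by (metis coprime_iff_gcd_eq_1 gcd_greatest_iff prime_factor_nat dvd_trans gcd_dvd1 gcd_dvd2)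
    have "p \<le> b" using p b by (intro dvd_imp_le) (auto simp: large_squarefree_upto_def)
    then have "real p \<le> y" using b zy by (auto simp: large_squarefree_upto_def squarefree_upto_def)
    then show False using p n by (auto simp: primes_upto_def)
  qed
  have "a dvd a' * m'" using eq by (metis dvd_triv_left)
  then have 1: "a dvd a'" using cop[OF a, of m'] m' by (simp add: sifted_def coprime_dvd_mult_left_iff)
  have "a' dvd a * m" using eq by (metis dvd_triv_left)
  then have 2: "a' dvd a" using cop[OF a', of m] m by (simp add: sifted_def coprime_dvd_mult_left_iff)
  have "a = a'" using 1 2 by (rule dvd_antisym)
  with eq a show "a = a' \<and> m = m'" by (auto simp: large_squarefree_upto_def)
qed

text \<open>With the smallest \<open>z\<close> and the largest \<open>y\<close>, a product of a
  counted pair lies in \<open>Omega_set\<close> unless it is at most \<open>sqrt N\<close>, lies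
  below the threshold \<open>M0\<close>, has an abnormal number of prime divisors, or is divisible
  by the square of some \<open>d > y\<close>. These exceptions form the error term.\<close>

lemma factored_count_le:
  fixes C M0 :: real
  defines "z \<equiv> (\<lambda>N. (ln (real N) / 2) powr 0.1)" and "y \<equiv> (\<lambda>N. ln (real N) powr C)"
  assumes N: "N \<ge> 3" and C: "C \<ge> 0" and zy: "z N \<le> y N" and zN: "z N \<le> sqrt (real N)" and y1: "y N > 1"
  shows "factored_count (real N) (z N) (y N) \<le> real (card {n \<in> Omega_set C M0. n \<le> N}) +
    (sqrt (real N) + (\<bar>M0\<bar> + 1) + real (card (omega_abnormal N)) + real N / (y N - 1))"
proof -
  define P where "P = (SIGMA a:large_squarefree_upto (z N). sifted (primes_upto (y N)) (real N / real a))"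
  define Q where "Q = {M\<in>{1..N}. \<exists>d. y N < real d \<and> d ^ 2 dvd M}"
  define G where "G = (\<lambda>(a, m). a * m) ` P"
  have lN: "ln (real N) > 0" using N by simp
  have "card G = card P" unfolding G_def P_def
    by (intro card_image smooth_rough_product_inj zy)
  then have count: "factored_count (real N) (z N) (y N) = real (card G)"
    by (simp add: factored_count_def P_def)
  have "G \<subseteq> {n \<in> Omega_set C M0. n \<le> N} \<union> ({1..nat \<lfloor>sqrt (real N)\<rfloor>} \<union> ({1..nat \<lfloor>\<bar>M0\<bar>\<rfloor> + 1} \<union> (omega_abnormal N \<union> Q)))"
  proof
    fix M assume "M \<in> G"
    then obtain a m where am: "M = a * m" "squarefree a" "real a \<le> z N" "3 \<le> a" "m > 0"
        "real m \<le> real N / real a" and sift: "\<And>p. prime p \<Longrightarrow> real p \<le> y N \<Longrightarrow> \<not> p dvd m"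
      by (auto simp: G_def P_def large_squarefree_upto_def squarefree_upto_def sifted_def primes_upto_def)
    have "real (a * m) \<le> real N" using am by (simp add: field_simps)
    then have MN: "M \<le> N" by (simp only: am(1) of_nat_le_iff)
    have M1: "M \<ge> 1" using am by simp
    show "M \<in> {n \<in> Omega_set C M0. n \<le> N} \<union> ({1..nat \<lfloor>sqrt (real N)\<rfloor>} \<union> ({1..nat \<lfloor>\<bar>M0\<bar>\<rfloor> + 1} \<union> (omega_abnormal N \<union> Q)))"
    proof (rule ccontr)
      assume no: "\<not> ?thesis"
      have sq: "sqrt (real N) < real M"
      proof (rule ccontr)
        assume "\<not> sqrt (real N) < real M"
        then have "M \<le> nat \<lfloor>sqrt (real N)\<rfloor>" by (intro le_nat_floor) auto
        then show False using no M1 by auto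
      qed
      have half: "ln (real N) / 2 < ln (real M)" using half_ln_less[of N M] sq N by simp
      have lM: "ln (real M) \<le> ln (real N)" using M1 MN by (intro ln_mono) auto
      have M0: "real M \<ge> M0"
      proof -
        have "M > nat \<lfloor>\<bar>M0\<bar>\<rfloor> + 1" using no M1 by auto
        then show ?thesis by linarith
      qed
      have om: "0.9 * ln (ln (real M)) < real (omega M)" "real (omega M) < 1.1 * ln (ln (real M))"
        using no M1 MN by (auto simp: omega_abnormal_def)
      \<comment> \<open>A square of a prime \<open>p > y\<close> would put \<open>M\<close> into
        \<open>Q\<close>. A prime \<open>p \<le> y\<close> does not divide \<open>m\<close>, so its
        square would divide the squarefree \<open>a\<close>.\<close>
      have sqf: "squarefree M"
      proof (rule ccontr)
        assume "\<not> squarefree M"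
        then obtain p where p: "prime p" "p ^ 2 dvd M"
          using squarefree_factorial_semiring[of M] M1 by auto
        have "real p \<le> y N" using no p M1 MN by (force simp: Q_def)
        then have "\<not> p dvd m" using sift p by auto
        then have "coprime (p ^ 2) m" using p by (simp add: prime_imp_coprime)
        then have "p ^ 2 dvd a" using p am(1) by (simp add: coprime_dvd_mult_left_iff)
        then show False using am(2) p squarefreeD[of a p] by auto
      qed
      \<comment> \<open>\<open>least_prime_divisor\<close> is meaningful only above 1. The case
        \<open>m = 1\<close> would give \<open>M = a \<le> z N \<le> sqrt N\<close>, which is
        already excluded.\<close>
      have "m \<noteq> 1"
      proof
        assume "m = 1"
        then have "real M \<le> z N" using am by simp
        then show False using sq zN by linarith
      qed
      then have lp: "prime (least_prime_divisor m)" "least_prime_divisor m dvd m"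
        using prime_dvd_least_prime_divisor[of m] am by auto
      have "y N < real (least_prime_divisor m)" using sift[OF lp(1)] lp(2) by force
      moreover have "ln (real M) powr C \<le> y N" unfolding y_def using half lM lN C by (intro powr_mono2) auto
      ultimately have big: "ln (real M) powr C < real (least_prime_divisor m)" by linarith
      have "z N \<le> ln (real M) powr 0.1" unfolding z_def using half lN by (intro powr_mono2) auto
      then have "real a \<le> ln (real M) powr 0.1" using am by linarith
      then have "M \<in> Omega_set C M0"
        unfolding Omega_set_def using M1 M0 sqf om am big by auto
      then show False using no MN by auto
    qed
  qed
  then have "card G \<le> card ({n \<in> Omega_set C M0. n \<le> N} \<union> ({1..nat \<lfloor>sqrt (real N)\<rfloor>} \<union> ({1..nat \<lfloor>\<bar>M0\<bar>\<rfloor> + 1} \<union> (omega_abnormal N \<union> Q))))"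
    by (intro card_mono) (auto simp: Q_def omega_abnormal_def)
  also have "\<dots> \<le> card {n \<in> Omega_set C M0. n \<le> N} + (card {1..nat \<lfloor>sqrt (real N)\<rfloor>} +
      (card {1..nat \<lfloor>\<bar>M0\<bar>\<rfloor> + 1} + (card (omega_abnormal N) + card Q)))"
    by (meson add_left_mono card_Un_le order_trans)
  finally have "card G \<le> card {n \<in> Omega_set C M0. n \<le> N} + (nat \<lfloor>sqrt (real N)\<rfloor> +
      (nat \<lfloor>\<bar>M0\<bar>\<rfloor> + 1 + (card (omega_abnormal N) + card Q)))" by simp
  from of_nat_mono[OF this, where ?'a = real]
  have "real (card G) \<le> real (card {n \<in> Omega_set C M0. n \<le> N}) + (real (nat \<lfloor>sqrt (real N)\<rfloor>) +
      (real (nat \<lfloor>\<bar>M0\<bar>\<rfloor> + 1) + (real (card (omega_abnormal N)) + real (card Q))))"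
    by (simp only: of_nat_add)
  moreover have "real (nat \<lfloor>sqrt (real N)\<rfloor>) \<le> sqrt (real N)" by simp
  moreover have "real (nat \<lfloor>\<bar>M0\<bar>\<rfloor> + 1) \<le> \<bar>M0\<bar> + 1" by simp
  moreover have "real (card Q) \<le> real N / (y N - 1)" unfolding Q_def by (rule card_large_square_divisor[OF y1])
  ultimately show ?thesis unfolding count by linarith
qed

text \<open>Squeezes the count between two values of \<open>factored_count\<close> with scale
  factors 1 and 1/2 in exchanged roles. Their limits agree, and \<open>r\<close> collects the
  exceptional sets, each o(N).\<close>

lemma Omega_set_density_nat:
  fixes C M0 :: real
  assumes C: "C > 1 / 2"
  shows "(\<lambda>N. real (card {n \<in> Omega_set C M0. n \<le> N}) / real N) \<longlonglongrightarrow>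
           exp (- euler_mascheroni) * (3 / (5 * pi\<^sup>2 * C))"
proof -
  define z where "z N = (ln (real N) / 2) powr 0.1" for N :: nat
  define y where "y N = ln (real N) powr C" for N :: nat
  define r where "r N = 1 / sqrt (real N) + (\<bar>M0\<bar> + 1) / real N + real (card (omega_abnormal N)) / real N + 1 / (y N - 1)" for N
  let ?T = "\<lambda>N. real (card {n \<in> Omega_set C M0. n \<le> N})"
  let ?d = "exp (- euler_mascheroni) * (3 / (5 * pi\<^sup>2 * C))"
  show ?thesis
  proof (rule tendsto_sandwich)
    show "\<forall>\<^sub>F N in sequentially. ?T N / real N \<le>
        1 / sqrt (real N) + factored_count (real N) ((1 * ln (real N)) powr 0.1) ((1 / 2 * ln (real N)) powr C) / real N"
      using eventually_ge_at_top[of 3]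
    proof eventually_elim
      case (elim N)
      have "?T N / real N \<le> (sqrt (real N) + factored_count (real N) (ln (real N) powr 0.1) ((ln (real N) / 2) powr C)) / real N"
        using C by (intro divide_right_mono card_Omega_set_le elim) auto
      also have "\<dots> = 1 / sqrt (real N) + factored_count (real N) (ln (real N) powr 0.1) ((ln (real N) / 2) powr C) / real N"
        using sqrt_div_self[of "real N"] elim by (simp add: add_divide_distrib)
      finally show ?case by simp
    qed
    have ev: "\<forall>\<^sub>F N in sequentially. z N \<le> y N" "\<forall>\<^sub>F N in sequentially. z N \<le> sqrt (real N)"
      "\<forall>\<^sub>F N in sequentially. y N > 1"
      unfolding z_def y_def using C by real_asymp+
    show "\<forall>\<^sub>F N in sequentially. factored_count (real N) ((1 / 2 * ln (real N)) powr 0.1) ((1 * ln (real N)) powr C) / real N - r N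
        \<le> ?T N / real N"
      using ev eventually_ge_at_top[of 3]
    proof eventually_elim
      case (elim N)
      have "factored_count (real N) (z N) (y N) / real N \<le>
          (?T N + (sqrt (real N) + (\<bar>M0\<bar> + 1) + real (card (omega_abnormal N)) + real N / (y N - 1))) / real N"
        unfolding z_def y_def using elim C
        by (intro divide_right_mono factored_count_le) (auto simp: z_def y_def)
      also have "\<dots> = ?T N / real N + r N"
        using sqrt_div_self[of "real N"] elim by (simp add: r_def add_divide_distrib)
      finally show ?case by (simp add: z_def y_def)
    qed
    have "(\<lambda>N. 1 / sqrt (real N)) \<longlonglongrightarrow> 0" by real_asymp
    from tendsto_add[OF this factored_count_asymp[of 1 "1 / 2" C]] C
    show "(\<lambda>N. 1 / sqrt (real N) + factored_count (real N) ((1 * ln (real N)) powr 0.1) ((1 / 2 * ln (real N)) powr C) / real N)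
        \<longlonglongrightarrow> ?d" by simp
    have "(\<lambda>N. 1 / sqrt (real N)) \<longlonglongrightarrow> 0" "(\<lambda>N. (\<bar>M0\<bar> + 1) / real N) \<longlonglongrightarrow> 0" by real_asymp+
    moreover have "(\<lambda>N. 1 / (y N - 1)) \<longlonglongrightarrow> 0" unfolding y_def using C by real_asymp
    ultimately have "r \<longlonglongrightarrow> 0 + 0 + 0 + 0"
      unfolding r_def by (intro tendsto_add Hardy_Ramanujan)
    from tendsto_diff[OF factored_count_asymp[of "1 / 2" 1 C] this] C
    show "(\<lambda>N. factored_count (real N) ((1 / 2 * ln (real N)) powr 0.1) ((1 * ln (real N)) powr C) / real N - r N) \<longlonglongrightarrow> ?d"
      by simp
  qed
qed

lemma has_asymptotic_densityI_nat:
  assumes "(\<lambda>N. real (card {n \<in> S. n \<le> N}) / real N) \<longlonglongrightarrow> d"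
  shows "has_asymptotic_density S d"
proof -
  have 1: "((\<lambda>X::real. real (card {n \<in> S. n \<le> nat \<lfloor>X\<rfloor>}) / real (nat \<lfloor>X\<rfloor>)) \<longlongrightarrow> d) at_top"
    by (rule filterlim_compose[OF assms filterlim_nat_floor_at_top])
  have 2: "((\<lambda>X::real. real (nat \<lfloor>X\<rfloor>) / X) \<longlongrightarrow> 1) at_top"
  proof (rule tendsto_sandwich)
    show "\<forall>\<^sub>F X::real in at_top. 1 - 1 / X \<le> real (nat \<lfloor>X\<rfloor>) / X"
      using eventually_ge_at_top[of 1]
    proof eventually_elim
      case (elim X)
      have "X - 1 \<le> real (nat \<lfloor>X\<rfloor>)" using elim by linarith
      then have "(X - 1) / X \<le> real (nat \<lfloor>X\<rfloor>) / X" using elim by (intro divide_right_mono) auto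
      then show ?case using elim by (simp add: diff_divide_distrib)
    qed
    show "\<forall>\<^sub>F X::real in at_top. real (nat \<lfloor>X\<rfloor>) / X \<le> 1"
      using eventually_ge_at_top[of 1] by eventually_elim auto
    show "((\<lambda>X::real. 1 - 1 / X) \<longlongrightarrow> 1) at_top" by real_asymp
  qed auto
  have "((\<lambda>X. real (card {n \<in> S. real n \<le> X}) / X) \<longlongrightarrow> d * 1) at_top"
  proof (rule Lim_transform_eventually[OF tendsto_mult[OF 1 2]])
    show "\<forall>\<^sub>F X::real in at_top. real (card {n \<in> S. n \<le> nat \<lfloor>X\<rfloor>}) / real (nat \<lfloor>X\<rfloor>) * (real (nat \<lfloor>X\<rfloor>) / X) =
        real (card {n \<in> S. real n \<le> X}) / X"
      using eventually_ge_at_top[of 1]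
    proof eventually_elim
      case (elim X)
      define k where "k = nat \<lfloor>X\<rfloor>"
      have "real n \<le> X \<longleftrightarrow> n \<le> k" for n unfolding k_def using elim by linarith
      moreover have "k \<noteq> 0" unfolding k_def using elim by linarith
      ultimately show ?case unfolding k_def[symmetric] by simp
    qed
  qed
  then show ?thesis by (simp add: has_asymptotic_density_def)
qed

theorem theorem1p4:
  fixes C\<^sub>0 M\<^sub>0 :: real
  assumes "C\<^sub>0 > 2"
  shows "has_asymptotic_density (Omega_set C\<^sub>0 M\<^sub>0)
           (exp (- euler_mascheroni) * (3 / (5 * pi\<^sup>2 * C\<^sub>0)))"
  using assms by (intro has_asymptotic_densityI_nat Omega_set_density_nat) auto

end
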